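(* The variety $\mathbb{P}^1\times \mathbb{P}^1$ is covered by one degree $4$ pseudo-chart with finite fibers; that is, there is a surjective morphism $f:\mathbb{A}^2\to\mathbb{P}^1\times\mathbb{P}^1$ of degree $4$ with finite fibers.
   Context: All varieties are over the complex field $\mathbb{C}$ (or, equivalently, over any algebraically closed field of characteristic zero). Let $X$ be an integral rational quasi-projective variety of dimension $n$. A pseudo-chart of $X$ is a morphism $f: \mathbb{A}^n\to X$ such that $\dim f(\mathbb{A}^n) = n$; it is a pseudo-chart with finite fibers if all fibers of $f$ are finite. Its degree is the degree of $f$ as a generically finite dominant morphism, i.e. the degree of the induced extension of function fields. $X$ is covered by a set of pseudo-charts if the union of their images is $X$. *)

theory Defs
  imports "HOL-Analysis.Analysis" "HOL-Algebra.Embedded_Algebras" "HOL-Library.Extended_Nat"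
begin

section \<open>Varieties as spaces with functions\<close>

text \<open>
  A complex variety is given by its closed points with the Zariski topology, together with the
  regular functions on each open set. A regular function on \<open>U\<close> is represented by a total function
  of which only the values on \<open>U\<close> matter.
\<close>

record 'a variety =
  zariski :: "'a topology"
  regular_on :: "'a set \<Rightarrow> ('a \<Rightarrow> complex) \<Rightarrow> bool"

abbreviation points :: "'a variety \<Rightarrow> 'a set" where
  "points X \<equiv> topspace (zariski X)"

definition morphism :: "'a variety \<Rightarrow> 'b variety \<Rightarrow> ('a \<Rightarrow> 'b) \<Rightarrow> bool" where
  "morphism X Y f \<longleftrightarrow>
     continuous_map (zariski X) (zariski Y) f \<and>
     (\<forall>V \<phi>. openin (zariski Y) V \<longrightarrow> regular_on Y V \<phi> \<longrightarrow>
        regular_on X {x \<in> points X. f x \<in> V} (\<lambda>x. \<phi> (f x)))"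

definition dominant :: "'a variety \<Rightarrow> 'b variety \<Rightarrow> ('a \<Rightarrow> 'b) \<Rightarrow> bool" where
  "dominant X Y f \<longleftrightarrow> zariski Y closure_of (f ` points X) = points Y"


section \<open>Affine space\<close>

inductive poly_fun :: "(complex ^ 'n \<Rightarrow> complex) \<Rightarrow> bool" where
  const: "poly_fun (\<lambda>_. c)"
| coord: "poly_fun (\<lambda>x. x $ i)"
| add: "poly_fun F \<Longrightarrow> poly_fun G \<Longrightarrow> poly_fun (\<lambda>x. F x + G x)"
| mult: "poly_fun F \<Longrightarrow> poly_fun G \<Longrightarrow> poly_fun (\<lambda>x. F x * G x)"

definition affine_zariski :: "(complex ^ 'n) topology" where
  "affine_zariski =
     topology (\<lambda>U. \<exists>S. (\<forall>F\<in>S. poly_fun F) \<and> U = - {x. \<forall>F\<in>S. F x = 0})"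

definition affine_regular :: "(complex ^ 'n) set \<Rightarrow> (complex ^ 'n \<Rightarrow> complex) \<Rightarrow> bool" where
  "affine_regular U \<phi> \<longleftrightarrow>
     (\<forall>x\<in>U. \<exists>V G H. openin affine_zariski V \<and> x \<in> V \<and> V \<subseteq> U \<and> poly_fun G \<and> poly_fun H \<and>
        (\<forall>y\<in>V. H y \<noteq> 0 \<and> \<phi> y = G y / H y))"

definition affine_space :: "(complex ^ 'n) variety" where
  "affine_space = \<lparr>zariski = affine_zariski, regular_on = affine_regular\<rparr>"

lemma openin_affine_zariski:
  fixes U :: "(complex ^ 'n) set"
  shows "openin affine_zariski U \<longleftrightarrow> (\<exists>S. (\<forall>F\<in>S. poly_fun F) \<and> U = - {x. \<forall>F\<in>S. F x = 0})"
proof -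
  let ?L = "\<lambda>U::(complex ^ 'n) set. \<exists>S. (\<forall>F\<in>S. poly_fun F) \<and> U = - {x. \<forall>F\<in>S. F x = 0}"
  have "istopology ?L"
    unfolding istopology_def
  proof (intro conjI allI impI)
    fix U V :: "(complex ^ 'n) set" assume "?L U" "?L V"
    then obtain S T where S: "\<forall>F\<in>S. poly_fun F" "U = - {x. \<forall>F\<in>S. F x = 0}"
      and T: "\<forall>F\<in>T. poly_fun F" "V = - {x. \<forall>F\<in>T. F x = 0}" by auto
    let ?R = "{\<lambda>x. F x * G x | F G. F \<in> S \<and> G \<in> T}"
    have "\<forall>F\<in>?R. poly_fun F" using S T by (auto intro: poly_fun.mult)
    moreover have "U \<inter> V = - {x. \<forall>F\<in>?R. F x = 0}"
    proof (intro Set.set_eqI iffI)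
      fix x assume "x \<in> U \<inter> V"
      then obtain F G where FG: "F \<in> S" "F x \<noteq> 0" "G \<in> T" "G x \<noteq> 0"
        unfolding S(2) T(2) by auto
      have "\<exists>H\<in>?R. H x \<noteq> 0"
      proof (intro bexI)
        show "F x * G x \<noteq> 0" using FG by simp
      qed (use FG in blast)
      then show "x \<in> - {x. \<forall>F\<in>?R. F x = 0}" by simp
    next
      fix x assume "x \<in> - {x. \<forall>F\<in>?R. F x = 0}"
      then obtain F G where "F \<in> S" "G \<in> T" "F x * G x \<noteq> 0" by auto
      then show "x \<in> U \<inter> V" unfolding S(2) T(2) by auto
    qed
    ultimately show "?L (U \<inter> V)" by (intro exI[of _ ?R] conjI)
  next
    fix \<K> :: "(complex ^ 'n) set set" assume "\<forall>U\<in>\<K>. ?L U"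
    from bchoice[OF this] obtain S where
      S: "\<forall>U\<in>\<K>. (\<forall>F\<in>S U. poly_fun F) \<and> U = - {x. \<forall>F\<in>S U. F x = 0}" ..
    have "- {x. \<forall>F\<in>\<Union>(S ` \<K>). F x = 0} = (\<Union>U\<in>\<K>. - {x. \<forall>F\<in>S U. F x = 0})" by auto
    also have "\<dots> = (\<Union>U\<in>\<K>. U)" by (rule SUP_cong[OF refl], rule sym, rule conjunct2, erule S[rule_format])
    finally have "\<Union>\<K> = - {x. \<forall>F\<in>\<Union>(S ` \<K>). F x = 0}" by simp
    moreover have "\<forall>F\<in>\<Union>(S ` \<K>). poly_fun F" using S by blast
    ultimately show "?L (\<Union>\<K>)" by (intro exI[of _ "\<Union>(S ` \<K>)"] conjI)
  qed
  then show ?thesis unfolding affine_zariski_def by (simp add: topology_inverse')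
qed


section \<open>Products of two projective spaces\<close>

text \<open>
  A point of the projective space of lines in \<open>complex ^ 'n\<close> (so of dimension \<open>CARD('n) - 1\<close>) is the
  set of all its vectors of homogeneous coordinates.
\<close>

definition proj_rel :: "((complex ^ 'n) \<times> (complex ^ 'n)) set" where
  "proj_rel = {(v, w). v \<noteq> 0 \<and> (\<exists>c. c \<noteq> 0 \<and> w = c *s v)}"

definition proj_points :: "(complex ^ 'n) set set" where
  "proj_points = {v. v \<noteq> 0} // proj_rel"

text \<open>
  \<open>bihom d e F\<close>: \<open>F\<close> is a bihomogeneous polynomial of bidegree \<open>(d, e)\<close> in the two groups of
  variables. The zero polynomial has every bidegree.
\<close>

inductive bihom :: "nat \<Rightarrow> nat \<Rightarrow> (complex ^ 'm \<Rightarrow> complex ^ 'n \<Rightarrow> complex) \<Rightarrow> bool" where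
  const: "bihom 0 0 (\<lambda>_ _. c)"
| coord1: "bihom 1 0 (\<lambda>v _. v $ i)"
| coord2: "bihom 0 1 (\<lambda>_ w. w $ j)"
| add: "bihom d e F \<Longrightarrow> bihom d e G \<Longrightarrow> bihom d e (\<lambda>v w. F v w + G v w)"
| mult: "bihom d e F \<Longrightarrow> bihom d' e' G \<Longrightarrow> bihom (d + d') (e + e') (\<lambda>v w. F v w * G v w)"

text \<open>
  The product variety: its closed sets are the common zero loci of families of bihomogeneous
  polynomials, and its regular functions are locally quotients of two such polynomials of the same
  bidegree. This is the structure induced by the Segre embedding.
\<close>

definition biproj_nonzero ::
  "(complex ^ 'm \<Rightarrow> complex ^ 'n \<Rightarrow> complex) set \<Rightarrow> ((complex ^ 'm) set \<times> (complex ^ 'n) set) set"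
where
  "biproj_nonzero S =
     proj_points \<times> proj_points - {(L, M). \<forall>F\<in>S. \<forall>v\<in>L. \<forall>w\<in>M. F v w = 0}"

definition biproj_zariski :: "((complex ^ 'm) set \<times> (complex ^ 'n) set) topology" where
  "biproj_zariski =
     topology (\<lambda>U. \<exists>S. (\<forall>F\<in>S. \<exists>d e. bihom d e F) \<and> U = biproj_nonzero S)"

definition biproj_regular ::
  "((complex ^ 'm) set \<times> (complex ^ 'n) set) set \<Rightarrow>
   ((complex ^ 'm) set \<times> (complex ^ 'n) set \<Rightarrow> complex) \<Rightarrow> bool"
where
  "biproj_regular U \<phi> \<longleftrightarrow>
     (\<forall>p\<in>U. \<exists>V d e G H. openin biproj_zariski V \<and> p \<in> V \<and> V \<subseteq> U \<and> bihom d e G \<and> bihom d e H \<and>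
        (\<forall>(L, M)\<in>V. \<forall>v\<in>L. \<forall>w\<in>M. H v w \<noteq> 0 \<and> \<phi> (L, M) = G v w / H v w))"

definition biproj :: "((complex ^ 'm) set \<times> (complex ^ 'n) set) variety" where
  "biproj = \<lparr>zariski = biproj_zariski, regular_on = biproj_regular\<rparr>"

abbreviation P1_times_P1 :: "((complex ^ 2) set \<times> (complex ^ 2) set) variety" where
  "P1_times_P1 \<equiv> biproj"

lemma bihom_scale: "bihom d e F \<Longrightarrow> F (a *s v) (b *s w) = a ^ d * b ^ e * F v w"
  by (induction rule: bihom.induct) (auto simp: algebra_simps power_add)

lemma bihom_zero_iff:
  assumes "bihom d e F" "L \<in> proj_points" "M \<in> proj_points" "v \<in> L" "w \<in> M" "v' \<in> L" "w' \<in> M"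
  shows "F v w = 0 \<longleftrightarrow> F v' w' = 0"
proof -
  obtain v0 w0 where "L = proj_rel `` {v0}" "M = proj_rel `` {w0}"
    using assms(2,3) unfolding proj_points_def by (auto elim!: quotientE)
  then obtain a b a' b' where "a \<noteq> 0" "b \<noteq> 0" "a' \<noteq> 0" "b' \<noteq> 0"
    "v = a *s v0" "w = b *s w0" "v' = a' *s v0" "w' = b' *s w0"
    using assms(4-7) unfolding proj_rel_def by auto
  then show ?thesis using bihom_scale[OF assms(1)] by simp
qed

lemma openin_biproj_zariski:
  fixes U :: "((complex ^ 'm) set \<times> (complex ^ 'n) set) set"
  shows "openin biproj_zariski U \<longleftrightarrow> (\<exists>S. (\<forall>F\<in>S. \<exists>d e. bihom d e F) \<and> U = biproj_nonzero S)"
proof -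
  let ?L = "\<lambda>U::((complex ^ 'm) set \<times> (complex ^ 'n) set) set.
    \<exists>S. (\<forall>F\<in>S. \<exists>d e. bihom d e F) \<and> U = biproj_nonzero S"
  have "istopology ?L"
    unfolding istopology_def
  proof (intro conjI allI impI)
    fix U V :: "((complex ^ 'm) set \<times> (complex ^ 'n) set) set" assume "?L U" "?L V"
    then obtain S T where S: "\<forall>F\<in>S. \<exists>d e. bihom d e F" "U = biproj_nonzero S"
      and T: "\<forall>F\<in>T. \<exists>d e. bihom d e F" "V = biproj_nonzero T" by auto
    let ?R = "{\<lambda>v w. F v w * G v w | F G. F \<in> S \<and> G \<in> T}"
    have R: "\<forall>F\<in>?R. \<exists>d e. bihom d e F" using S T by (blast intro: bihom.mult)
    have "p \<in> U \<inter> V \<longleftrightarrow> p \<in> biproj_nonzero ?R" for p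
    proof (cases p)
      case (Pair L M)
      show ?thesis
      proof
        assume "p \<in> U \<inter> V"
        then obtain F v w G v' w' where
          *: "L \<in> proj_points" "M \<in> proj_points"
             "F \<in> S" "v \<in> L" "w \<in> M" "F v w \<noteq> 0" "G \<in> T" "v' \<in> L" "w' \<in> M" "G v' w' \<noteq> 0"
          unfolding S(2) T(2) biproj_nonzero_def Pair by auto
        then obtain d e where "bihom d e G" using T(1) by blast
        from bihom_zero_iff[OF this *(1,2,4,5,8,9)] have "G v w \<noteq> 0" using *(10) by simp
        have "\<exists>H\<in>?R. \<exists>v\<in>L. \<exists>w\<in>M. H v w \<noteq> 0"
        proof (intro bexI)
          show "F v w * G v w \<noteq> 0" using \<open>F v w \<noteq> 0\<close> \<open>G v w \<noteq> 0\<close> by simp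
        qed (use * in blast)+
        then show "p \<in> biproj_nonzero ?R"
          unfolding biproj_nonzero_def Pair using *(1,2) by simp
      next
        assume "p \<in> biproj_nonzero ?R"
        then obtain F G v w where "L \<in> proj_points" "M \<in> proj_points"
          "F \<in> S" "G \<in> T" "v \<in> L" "w \<in> M" "F v w * G v w \<noteq> 0"
          unfolding biproj_nonzero_def Pair by auto
        then show "p \<in> U \<inter> V"
          unfolding S(2) T(2) biproj_nonzero_def Pair by auto
      qed
    qed
    then show "?L (U \<inter> V)" using R by (intro exI[of _ ?R]) auto
  next
    fix \<K> :: "((complex ^ 'm) set \<times> (complex ^ 'n) set) set set" assume "\<forall>U\<in>\<K>. ?L U"
    from bchoice[OF this] obtain S where
      S: "\<forall>U\<in>\<K>. (\<forall>F\<in>S U. \<exists>d e. bihom d e F) \<and> U = biproj_nonzero (S U)" ..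
    have "biproj_nonzero (\<Union>(S ` \<K>)) = (\<Union>U\<in>\<K>. biproj_nonzero (S U))"
      unfolding biproj_nonzero_def by blast
    also have "\<dots> = (\<Union>U\<in>\<K>. U)" by (rule SUP_cong[OF refl], rule sym, rule conjunct2, erule S[rule_format])
    finally have "\<Union>\<K> = biproj_nonzero (\<Union>(S ` \<K>))" by simp
    moreover have "\<forall>F\<in>\<Union>(S ` \<K>). \<exists>d e. bihom d e F" using S by blast
    ultimately show "?L (\<Union>\<K>)" by (intro exI[of _ "\<Union>(S ` \<K>)"] conjI)
  qed
  then show ?thesis unfolding biproj_zariski_def by (simp add: topology_inverse')
qed


section \<open>Krull dimension\<close>

definition irreducible_closedin :: "'a topology \<Rightarrow> 'a set \<Rightarrow> bool" where
  "irreducible_closedin T Z \<longleftrightarrow>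
     closedin T Z \<and> Z \<noteq> {} \<and>
     (\<forall>A B. closedin T A \<longrightarrow> closedin T B \<longrightarrow> Z \<subseteq> A \<union> B \<longrightarrow> Z \<subseteq> A \<or> Z \<subseteq> B)"

text \<open>For the empty space the supremum below gives dimension 0.\<close>

definition krull_dim :: "'a topology \<Rightarrow> enat" where
  "krull_dim T =
     Sup {enat n | n. \<exists>Z :: nat \<Rightarrow> 'a set.
            (\<forall>i\<le>n. irreducible_closedin T (Z i)) \<and> (\<forall>i<n. Z i \<subset> Z (Suc i))}"


section \<open>Function fields and degrees\<close>

text \<open>
  For an irreducible variety, \<open>rational_class X U \<phi>\<close> is the rational function represented by the
  regular function \<open>\<phi>\<close> on the nonempty open set \<open>U\<close>: the class of all pairs \<open>(V, \<psi>)\<close> that agree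
  with \<open>(U, \<phi>)\<close> on the (again nonempty) intersection \<open>U \<inter> V\<close>.
\<close>

definition rational_reps :: "'a variety \<Rightarrow> ('a set \<times> ('a \<Rightarrow> complex)) set" where
  "rational_reps X = {(U, \<phi>). openin (zariski X) U \<and> U \<noteq> {} \<and> regular_on X U \<phi>}"

definition rational_class ::
  "'a variety \<Rightarrow> 'a set \<Rightarrow> ('a \<Rightarrow> complex) \<Rightarrow> ('a set \<times> ('a \<Rightarrow> complex)) set" where
  "rational_class X U \<phi> = {(V, \<psi>) \<in> rational_reps X. \<forall>x\<in>U \<inter> V. \<phi> x = \<psi> x}"

text \<open>
  In the ring operations and the pullback the unions range over the representatives of the
  arguments; all of them yield the same class.
\<close>

definition function_field :: "'a variety \<Rightarrow> ('a set \<times> ('a \<Rightarrow> complex)) set ring" where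
  "function_field X =
     \<lparr>carrier = {rational_class X U \<phi> | U \<phi>. (U, \<phi>) \<in> rational_reps X},
      mult = (\<lambda>a b. \<Union>(U, \<phi>)\<in>a. \<Union>(V, \<psi>)\<in>b. rational_class X (U \<inter> V) (\<lambda>x. \<phi> x * \<psi> x)),
      one = rational_class X (points X) (\<lambda>_. 1),
      zero = rational_class X (points X) (\<lambda>_. 0),
      add = (\<lambda>a b. \<Union>(U, \<phi>)\<in>a. \<Union>(V, \<psi>)\<in>b. rational_class X (U \<inter> V) (\<lambda>x. \<phi> x + \<psi> x))\<rparr>"

definition pullback ::
  "'a variety \<Rightarrow> ('a \<Rightarrow> 'b) \<Rightarrow>
   ('b set \<times> ('b \<Rightarrow> complex)) set \<Rightarrow> ('a set \<times> ('a \<Rightarrow> complex)) set" where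
  "pullback X f b = (\<Union>(V, \<psi>)\<in>b. rational_class X {x \<in> points X. f x \<in> V} (\<lambda>x. \<psi> (f x)))"

definition has_degree :: "'a variety \<Rightarrow> 'b variety \<Rightarrow> ('a \<Rightarrow> 'b) \<Rightarrow> nat \<Rightarrow> bool" where
  "has_degree X Y f d \<longleftrightarrow>
     morphism X Y f \<and> dominant X Y f \<and>
     ring.dimension (function_field X) d
       (pullback X f ` carrier (function_field Y)) (carrier (function_field X))"


section \<open>Pseudo-charts\<close>

definition pseudo_chart :: "'a variety \<Rightarrow> (complex ^ 'n \<Rightarrow> 'a) \<Rightarrow> bool" where
  "pseudo_chart X f \<longleftrightarrow>
     krull_dim (zariski X) = enat CARD('n) \<and>
     morphism affine_space X f \<and>
     krull_dim (subtopology (zariski X) (range f)) = enat CARD('n)"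

definition finite_fibers :: "'a variety \<Rightarrow> (complex ^ 'n \<Rightarrow> 'a) \<Rightarrow> bool" where
  "finite_fibers X f \<longleftrightarrow> (\<forall>p\<in>points X. finite {x. f x = p})"

definition covered_by :: "'a variety \<Rightarrow> (complex ^ 'n \<Rightarrow> 'a) set \<Rightarrow> bool" where
  "covered_by X \<F> \<longleftrightarrow> (\<forall>f\<in>\<F>. pseudo_chart X f) \<and> (\<Union>f\<in>\<F>. range f) = points X"

end

theory Submission
  imports Defs
begin

text \<open>
  The witness is \<open>f (x, y) = ([x\<^sup>2 + 1 : x], [y\<^sup>2 + 1 : y])\<close>, two copies of the Joukowski map
  \<open>x \<mapsto> x + 1 / x\<close>. As a map of the projective line to itself the Joukowski map has degree 2 and
  sends both \<open>0\<close> and \<open>\<infinity>\<close> to \<open>\<infinity>\<close>, so removing the source point \<open>\<infinity>\<close> loses no value: already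
  \<open>\<bbbA>\<^sup>1 \<rightarrow> \<bbbP>\<^sup>1\<close> is onto. The preimages of \<open>[v\<^sub>1 : v\<^sub>2]\<close> are the roots of \<open>v\<^sub>2 t\<^sup>2 - v\<^sub>1 t + v\<^sub>2\<close>, a nonzero
  polynomial with at least one and at most two roots, so \<open>f\<close> is onto and has finite fibers.
  
  Degree. Put \<open>u = x + 1 / x\<close> and \<open>v = y + 1 / y\<close>. The field extension in question is
  \<open>\<complex>(x, y)\<close> over \<open>\<complex>(u, v)\<close>, with basis \<open>1, x, y, xy\<close>. Linear independence is read off at a single
  general orbit \<open>(x\<^sup>\<plusminus>\<^sup>1, y\<^sup>\<plusminus>\<^sup>1)\<close>, along which the coefficients are constant. For the spanning property,
  \<open>x\<^sup>2 = u x - 1\<close> shows that the combinations of the basis over \<open>\<complex>[u, v]\<close> form a ring that contains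
  all polynomials (\<open>function_algebra_quad_ext\<close>), and taking norms first for \<open>y\<close> and then for \<open>x\<close> turns
  any denominator into a polynomial in \<open>u, v\<close> (\<open>quad_ext_norm\<close>, \<open>fraction_in_basis\<close>). Homogenization
  identifies quotients of polynomials in \<open>u, v\<close> with pullbacks of rational functions on the target.
  
  Dimension. Since \<open>f\<close> is onto, the only dimension needed is that of \<open>\<bbbP>\<^sup>1 \<times> \<bbbP>\<^sup>1\<close>. The bound from below is the
  chain point, line, whole surface; all three are images under \<open>f\<close> of affine subspaces of the plane,
  and these are irreducible because a polynomial on a line has finitely many zeros. For the bound
  from above, a chain of irreducible closed sets is restricted to an affine chart around a point of
  its smallest member. In the affine plane a proper closed subset of an irreducible curve is finite:
  in \<open>R[t]\<close>, over a domain \<open>R\<close>, an ideal that strictly contains a nonzero prime ideal contains a nonzero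
  constant (\<open>prime_chain_meets_base_ring\<close>), which with \<open>R = \<complex>[x]\<close> or \<open>R = \<complex>[y]\<close> bounds both coordinates.
\<close>

section \<open>Prime ideals in a polynomial ring over a domain\<close>

text \<open>
  Choose \<open>F\<close> of least degree among the nonzero elements of \<open>I\<close> and \<open>H\<close> of least degree in \<open>J\<close> outside \<open>I\<close>.
  If \<open>J\<close> contained no nonzero constant, pseudo-division of these two by one another would make \<open>F\<close>, up
  to a constant, a multiple of \<open>H\<close>, and the cofactor would lie in the prime ideal \<open>I\<close> with degree less
  than that of \<open>F\<close>. Pseudo-division takes the place of passing to the fraction field of the base ring.
\<close>

lemma prime_chain_meets_base_ring:
  fixes I J :: "'a :: idom poly set"
  assumes I_zero: "0 \<in> I"
    and I_diff: "\<And>P Q. P \<in> I \<Longrightarrow> Q \<in> I \<Longrightarrow> P - Q \<in> I"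
    and I_mult: "\<And>P Q. P \<in> I \<Longrightarrow> P * Q \<in> I"
    and I_prime: "\<And>P Q. P * Q \<in> I \<Longrightarrow> P \<in> I \<or> Q \<in> I"
    and J_diff: "\<And>P Q. P \<in> J \<Longrightarrow> Q \<in> J \<Longrightarrow> P - Q \<in> J"
    and J_mult: "\<And>P Q. P \<in> J \<Longrightarrow> P * Q \<in> J"
    and sub: "I \<subseteq> J"
    and F0: "F0 \<in> I" "F0 \<noteq> 0"
    and G0: "G0 \<in> J" "G0 \<notin> I"
  shows "\<exists>d. d \<noteq> 0 \<and> [:d:] \<in> J"
proof (rule ccontr)
  assume contra: "\<not> ?thesis"
  have J0: "[:d:] \<notin> J" if "d \<noteq> 0" for d using contra that by blast
  have "\<exists>F. (F \<in> I \<and> F \<noteq> 0) \<and> (\<forall>P. P \<in> I \<and> P \<noteq> 0 \<longrightarrow> degree F \<le> degree P)"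
    using ex_has_least_nat[of "\<lambda>P. P \<in> I \<and> P \<noteq> 0" F0 degree] F0 by blast
  then obtain F where F: "F \<in> I" "F \<noteq> 0" "\<And>P. P \<in> I \<Longrightarrow> P \<noteq> 0 \<Longrightarrow> degree F \<le> degree P" by blast
  have "\<exists>H. (H \<in> J \<and> H \<notin> I) \<and> (\<forall>P. P \<in> J \<and> P \<notin> I \<longrightarrow> degree H \<le> degree P)"
    using ex_has_least_nat[of "\<lambda>P. P \<in> J \<and> P \<notin> I" G0 degree] G0 by blast
  then obtain H where H: "H \<in> J" "H \<notin> I" "\<And>P. P \<in> J \<Longrightarrow> P \<notin> I \<Longrightarrow> degree H \<le> degree P" by blast
  have "H \<noteq> 0" using H(2) I_zero by blast
  have smult_J: "Polynomial.smult a P \<in> J" if "P \<in> J" for a P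
    using J_mult[OF that, of "[:a:]"] by simp
  have smult_I: "Polynomial.smult a P \<in> I" if "P \<in> I" for a P
    using I_mult[OF that, of "[:a:]"] by simp
  have smult_I_iff: "P \<in> I" if "Polynomial.smult a P \<in> I" "a \<noteq> 0" for a P
  proof -
    have "[:a:] * P \<in> I" using that(1) by simp
    then show ?thesis using I_prime J0[OF that(2)] sub by blast
  qed
  have degH: "degree H > 0"
  proof (rule ccontr)
    assume "\<not> 0 < degree H"
    then obtain d where "H = [:d:]" by (metis degree_eq_zeroE not_gr_zero)
    then show False using J0 H(1) \<open>H \<noteq> 0\<close> by auto
  qed
  \<comment> \<open>Reducing \<open>H\<close> modulo \<open>F\<close> shows that \<open>H\<close> has smaller degree than \<open>F\<close>.\<close>
  have HF: "degree H < degree F"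
  proof -
    obtain a q where aq: "a \<noteq> 0" "Polynomial.smult a H = F * q + pseudo_mod H F"
      using pseudo_mod(1)[OF F(2)] by blast
    have eq: "pseudo_mod H F = Polynomial.smult a H - F * q" using aq(2) by simp
    have "pseudo_mod H F \<in> J"
      unfolding eq using F(1) sub H(1) by (intro J_diff smult_J J_mult) auto
    moreover have notI: "pseudo_mod H F \<notin> I"
    proof
      assume "pseudo_mod H F \<in> I"
      moreover have "0 - F * q \<in> I" using F(1) by (intro I_diff I_zero I_mult)
      ultimately have "pseudo_mod H F - (0 - F * q) \<in> I" by (rule I_diff)
      then have "Polynomial.smult a H \<in> I" using aq(2) by (simp add: add.commute)
      then show False using smult_I_iff aq(1) H(2) by blast
    qed
    ultimately have "degree H \<le> degree (pseudo_mod H F)" by (rule H(3))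
    moreover have "pseudo_mod H F \<noteq> 0" using notI I_zero by auto
    ultimately show ?thesis using pseudo_mod(2)[OF F(2), of H] by simp
  qed
  \<comment> \<open>Reducing \<open>F\<close> modulo \<open>H\<close> leaves no remainder, and the quotient contradicts the choice of \<open>F\<close>.\<close>
  obtain a q where aq: "a \<noteq> 0" "Polynomial.smult a F = H * q + pseudo_mod F H"
    using pseudo_mod(1)[OF \<open>H \<noteq> 0\<close>] by blast
  have eq: "pseudo_mod F H = Polynomial.smult a F - H * q" using aq(2) by simp
  have "pseudo_mod F H = 0"
  proof (rule ccontr)
    assume nz: "pseudo_mod F H \<noteq> 0"
    then have lt: "degree (pseudo_mod F H) < degree H"
      using pseudo_mod(2)[OF \<open>H \<noteq> 0\<close>, of F] by simp
    have "pseudo_mod F H \<in> J"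
      unfolding eq using F(1) sub H(1) by (intro J_diff smult_J J_mult) auto
    then have "pseudo_mod F H \<in> I" using H(3) lt by (meson not_le)
    then show False using F(3) nz lt HF by fastforce
  qed
  then have qF: "Polynomial.smult a F = H * q" using aq(2) by simp
  then have "q \<in> I" using smult_I[OF F(1), of a] I_prime H(2) by metis
  moreover have "q \<noteq> 0" using qF aq(1) F(2) by auto
  moreover have "degree F = degree H + degree q"
    using arg_cong[OF qF, of degree] aq(1) \<open>H \<noteq> 0\<close> \<open>q \<noteq> 0\<close> by (simp add: degree_mult_eq)
  ultimately show False using F(3)[of q] degH by simp
qed

section \<open>Zariski topology of affine space\<close>

lemma topspace_affine_zariski [simp]: "topspace affine_zariski = (UNIV :: (complex ^ 'n) set)"
proof -
  have "openin affine_zariski (UNIV :: (complex ^ 'n) set)"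
    unfolding openin_affine_zariski by (intro exI[of _ "{\<lambda>_. 1}"]) (auto intro: poly_fun.const)
  then show ?thesis using openin_subset by blast
qed

lemma closedin_affine_zariski:
  fixes Z :: "(complex ^ 'n) set"
  shows "closedin affine_zariski Z \<longleftrightarrow> (\<exists>S. (\<forall>F\<in>S. poly_fun F) \<and> Z = {x. \<forall>F\<in>S. F x = 0})"
proof -
  have "(UNIV - Z = - A) \<longleftrightarrow> (Z = A)" for A by blast
  then show ?thesis unfolding closedin_def openin_affine_zariski by simp
qed

lemma closedin_zero_locus: "poly_fun F \<Longrightarrow> closedin affine_zariski {x. F x = 0}"
  unfolding closedin_affine_zariski by (intro exI[of _ "{F}"]) auto

lemma openin_nonzero_locus: "poly_fun F \<Longrightarrow> openin affine_zariski {x. F x \<noteq> 0}"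
  unfolding openin_affine_zariski by (intro exI[of _ "{F}"]) auto

lemma closedin_affine_zariski_separate:
  assumes "closedin affine_zariski Z" "x \<notin> Z"
  obtains F where "poly_fun F" "\<And>z. z \<in> Z \<Longrightarrow> F z = 0" "F x \<noteq> 0"
  using assms unfolding closedin_affine_zariski by blast

lemma openin_affine_zariski_basic:
  assumes "openin affine_zariski U" "x \<in> U"
  obtains F where "poly_fun F" "F x \<noteq> 0" "\<And>y. F y \<noteq> 0 \<Longrightarrow> y \<in> U"
  using assms unfolding openin_affine_zariski by blast

lemma poly_fun_diff:
  assumes "poly_fun F" "poly_fun G" shows "poly_fun (\<lambda>x. F x - G x)"
proof -
  have "poly_fun (\<lambda>x. F x + (-1) * G x)"
    by (intro poly_fun.add poly_fun.mult poly_fun.const assms)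
  then show ?thesis by simp
qed

lemma poly_fun_power: "poly_fun F \<Longrightarrow> poly_fun (\<lambda>x. F x ^ k)"
  by (induction k) (auto intro: poly_fun.const poly_fun.mult)

lemma poly_fun_on_line:
  assumes "poly_fun F"
  shows "\<exists>p. \<forall>t. F (a + t *s b) = poly p t"
  using assms
proof induction
  case (const c)
  show ?case by (intro exI[of _ "[:c:]"]) simp
next
  case (coord i)
  show ?case by (intro exI[of _ "[:a $ i, b $ i:]"]) simp
next
  case (add F G)
  then obtain p q where "\<forall>t. F (a + t *s b) = poly p t" "\<forall>t. G (a + t *s b) = poly q t" by blast
  then show ?case by (intro exI[of _ "p + q"]) simp
next
  case (mult F G)
  then obtain p q where "\<forall>t. F (a + t *s b) = poly p t" "\<forall>t. G (a + t *s b) = poly q t" by blast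
  then show ?case by (intro exI[of _ "p * q"]) simp
qed

text \<open>
  If \<open>F\<close> is nonzero at \<open>a\<close> and \<open>G\<close> at \<open>b\<close>, the two restrict to nonzero polynomials in one variable on the
  line through \<open>a\<close> and \<open>b\<close>, and so does their product.
\<close>

lemma affine_subspace_prime:
  assumes "poly_fun F" "poly_fun G"
    and S: "\<And>a b t. a \<in> S \<Longrightarrow> b \<in> S \<Longrightarrow> a + t *s (b - a) \<in> S"
    and zero: "\<And>x. x \<in> S \<Longrightarrow> F x * G x = 0"
  shows "(\<forall>x\<in>S. F x = 0) \<or> (\<forall>x\<in>S. G x = 0)"
proof (rule ccontr)
  assume "\<not> ?thesis"
  then obtain a b where ab: "a \<in> S" "F a \<noteq> 0" "b \<in> S" "G b \<noteq> 0" by blast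
  obtain p where p: "\<And>t. F (a + t *s (b - a)) = poly p t"
    using poly_fun_on_line[OF assms(1)] by metis
  obtain q where q: "\<And>t. G (a + t *s (b - a)) = poly q t"
    using poly_fun_on_line[OF assms(2)] by metis
  have "poly (p * q) t = 0" for t
    using zero[OF S[OF ab(1,3)], of t] unfolding p q by simp
  then have "p * q = 0" using poly_all_0_iff_0 by blast
  moreover have "poly p 0 \<noteq> 0" using ab(2) p[of 0] by simp
  moreover have "poly q 1 \<noteq> 0" using ab(4) q[of 1] by simp
  ultimately show False by auto
qed

lemma irreducible_affine_subspace:
  assumes "closedin affine_zariski S" "S \<noteq> {}"
    and "\<And>a b t. a \<in> S \<Longrightarrow> b \<in> S \<Longrightarrow> a + t *s (b - a) \<in> S"
  shows "irreducible_closedin affine_zariski S"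
  unfolding irreducible_closedin_def
proof (intro conjI allI impI assms(1,2))
  fix A B
  assume AB: "closedin affine_zariski A" "closedin affine_zariski B" "S \<subseteq> A \<union> B"
  show "S \<subseteq> A \<or> S \<subseteq> B"
  proof (rule ccontr)
    assume "\<not> ?thesis"
    then obtain a b where ab: "a \<in> S" "a \<notin> A" "b \<in> S" "b \<notin> B" by blast
    from closedin_affine_zariski_separate[OF AB(1) ab(2)]
    obtain F where F: "poly_fun F" "\<And>z. z \<in> A \<Longrightarrow> F z = 0" "F a \<noteq> 0" by blast
    from closedin_affine_zariski_separate[OF AB(2) ab(4)]
    obtain G where G: "poly_fun G" "\<And>z. z \<in> B \<Longrightarrow> G z = 0" "G b \<noteq> 0" by blast
    have FG: "F x * G x = 0" if "x \<in> S" for x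
      using that AB(3) F(2)[of x] G(2)[of x] by auto
    have "(\<forall>x\<in>S. F x = 0) \<or> (\<forall>x\<in>S. G x = 0)"
      by (rule affine_subspace_prime[OF F(1) G(1) assms(3) FG])
    then show False using ab F G by blast
  qed
qed

lemma poly_fun_zero_of_open:
  assumes "poly_fun F" "openin affine_zariski U" "U \<noteq> {}" "\<And>x. x \<in> U \<Longrightarrow> F x = 0"
  shows "F x = 0"
proof -
  obtain a where "a \<in> U" using assms(3) by blast
  obtain G where G: "poly_fun G" "G a \<noteq> 0" "\<And>y. G y \<noteq> 0 \<Longrightarrow> y \<in> U"
    using openin_affine_zariski_basic[OF assms(2) \<open>a \<in> U\<close>] by blast
  have "(\<forall>x\<in>UNIV. F x = 0) \<or> (\<forall>x\<in>UNIV. G x = 0)"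
    using affine_subspace_prime[OF assms(1) G(1)] assms(4) G(3) by auto
  then show ?thesis using G(2) by blast
qed

lemma affine_opens_meet:
  assumes "openin affine_zariski U" "openin affine_zariski V" "U \<noteq> {}" "V \<noteq> {}"
  shows "U \<inter> V \<noteq> {}"
proof
  assume disj: "U \<inter> V = {}"
  obtain a where "a \<in> V" using assms(4) by blast
  obtain G where G: "poly_fun G" "G a \<noteq> 0" "\<And>y. G y \<noteq> 0 \<Longrightarrow> y \<in> V"
    using openin_affine_zariski_basic[OF assms(2) \<open>a \<in> V\<close>] by blast
  have "G a = 0" using poly_fun_zero_of_open[OF G(1) assms(1,3)] G(3) disj by blast
  then show False using G(2) by simp
qed

lemma irreducible_closedin_image:
  assumes "irreducible_closedin T S" "continuous_map T T' g" "closedin T' (g ` S)"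
  shows "irreducible_closedin T' (g ` S)"
  unfolding irreducible_closedin_def
proof (intro conjI allI impI assms(3))
  show "g ` S \<noteq> {}" using assms(1) by (simp add: irreducible_closedin_def)
next
  fix A B
  assume AB: "closedin T' A" "closedin T' B" "g ` S \<subseteq> A \<union> B"
  have S: "S \<subseteq> topspace T"
    using assms(1) by (simp add: irreducible_closedin_def closedin_subset)
  let ?p = "\<lambda>A. {x \<in> topspace T. g x \<in> A}"
  have "closedin T (?p A)" "closedin T (?p B)"
    using AB(1,2) assms(2) by (auto intro: closedin_continuous_map_preimage)
  moreover have "S \<subseteq> ?p A \<union> ?p B" using AB(3) S by blast
  ultimately have "S \<subseteq> ?p A \<or> S \<subseteq> ?p B"
    using assms(1) unfolding irreducible_closedin_def by blast
  then show "g ` S \<subseteq> A \<or> g ` S \<subseteq> B" by blast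
qed

text \<open>
  A finite set of closed points is the union of its singletons, and an irreducible set lies in one
  member of any finite closed cover.
\<close>

lemma irreducible_finite_singleton:
  assumes "irreducible_closedin T W" "finite W" and pts: "\<And>x. x \<in> W \<Longrightarrow> closedin T {x}"
  shows "\<exists>x. W = {x}"
proof -
  have "A \<subseteq> W \<Longrightarrow> W \<subseteq> A \<Longrightarrow> \<exists>x\<in>A. W \<subseteq> {x}" if "finite A" for A
  proof -
    have "A \<noteq> {} \<Longrightarrow> A \<subseteq> W \<Longrightarrow> W \<subseteq> A \<Longrightarrow> \<exists>x\<in>A. W \<subseteq> {x}"
      using that
    proof (induction A)
      case (insert a A)
      have clA: "closedin T A"
        using insert.prems(2) insert.hyps(1) pts closedin_Union[of "(\<lambda>x. {x}) ` A" T] by auto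
      have "W \<subseteq> {a} \<union> A" "closedin T {a}" using insert.prems pts by auto
      then consider "W \<subseteq> {a}" | "W \<subseteq> A"
        using assms(1) clA unfolding irreducible_closedin_def by blast
      then show ?case
      proof cases
        case 2
        then have "A \<noteq> {}" using insert.prems by blast
        then show ?thesis using insert.IH insert.prems 2 by blast
      qed blast
    qed simp
    then show "A \<subseteq> W \<Longrightarrow> W \<subseteq> A \<Longrightarrow> \<exists>x\<in>A. W \<subseteq> {x}"
      using assms(1) unfolding irreducible_closedin_def by blast
  qed
  from this[OF assms(2) order_refl order_refl] obtain x where "x \<in> W" "W \<subseteq> {x}" by blast
  then show ?thesis by blast
qed

lemma closedin_affine_point: "closedin affine_zariski {a :: complex ^ 'n}"
  unfolding closedin_affine_zariski
  by (intro exI[of _ "{\<lambda>x. x $ i - a $ i | i. True}"])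
     (fastforce simp: vec_eq_iff intro: poly_fun_diff poly_fun.coord poly_fun.const)

text \<open>
  Either coordinate may serve as the outer variable; using both choices makes the argument
  for finiteness below symmetric in the two coordinates.
\<close>

lemma poly_fun_bivariate:
  fixes F :: "complex ^ 2 \<Rightarrow> complex"
  assumes "poly_fun F" "i \<noteq> j"
  shows "\<exists>P. \<forall>z. F z = poly (poly P [:z $ j:]) (z $ i)"
  using assms(1)
proof induction
  case (const c)
  show ?case by (intro exI[of _ "[:[:c:]:]"]) simp
next
  case (coord k)
  have "k = i \<or> k = j" using \<open>i \<noteq> j\<close> exhaust_2[of i] exhaust_2[of j] exhaust_2[of k] by auto
  then show ?case
  proof
    assume "k = i" then show ?thesis by (intro exI[of _ "[:[:0, 1:]:]"]) simp
  next
    assume "k = j" then show ?thesis by (intro exI[of _ "[:0, 1:]"]) simp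
  qed
next
  case (add F G)
  then obtain P Q where "\<forall>z. F z = poly (poly P [:z $ j:]) (z $ i)"
    "\<forall>z. G z = poly (poly Q [:z $ j:]) (z $ i)" by blast
  then show ?case by (intro exI[of _ "P + Q"]) simp
next
  case (mult F G)
  then obtain P Q where "\<forall>z. F z = poly (poly P [:z $ j:]) (z $ i)"
    "\<forall>z. G z = poly (poly Q [:z $ j:]) (z $ i)" by blast
  then show ?case by (intro exI[of _ "P * Q"]) simp
qed

lemma poly_fun_of_univariate: "poly_fun (\<lambda>z. poly p (z $ i))"
proof (induction p)
  case (pCons a p)
  show ?case unfolding poly_pCons
    by (intro poly_fun.add poly_fun.mult poly_fun.const poly_fun.coord pCons.IH)
qed (simp add: poly_fun.const)

lemma poly_fun_of_bivariate: "poly_fun (\<lambda>z. poly (poly P [:z $ j:]) (z $ i))"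
proof (induction P)
  case (pCons p P)
  have "poly (poly (pCons p P) [:z $ j:]) (z $ i) =
      poly p (z $ i) + z $ j * poly (poly P [:z $ j:]) (z $ i)" for z
    by simp
  then show ?case
    by (simp only:) (intro poly_fun.add poly_fun.mult poly_fun.coord poly_fun_of_univariate pCons.IH)
qed (simp add: poly_fun.const)

text \<open>
  The polynomials vanishing on \<open>Z\<close> form a nonzero prime ideal, strictly contained in the ideal of \<open>W\<close>.
  Hence some nonzero polynomial in one coordinate alone vanishes on \<open>W\<close>, and this holds for either
  coordinate.
\<close>

lemma proper_closed_in_curve_finite:
  fixes Z W :: "(complex ^ 2) set"
  assumes irr: "irreducible_closedin affine_zariski Z" and "Z \<noteq> UNIV"
    and W: "closedin affine_zariski W" "W \<subset> Z"
  shows "finite W"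
proof -
  have coord_finite: "finite ((\<lambda>z. z $ i) ` W)" if ij: "i \<noteq> j" for i j :: 2
  proof -
    let ?ev = "\<lambda>P z. poly (poly P [:z $ j:]) (z $ i) :: complex"
    let ?I = "{P. \<forall>z\<in>Z. ?ev P z = 0}" and ?J = "{P. \<forall>z\<in>W. ?ev P z = 0}"
    have Zcl: "closedin affine_zariski Z" using irr by (simp add: irreducible_closedin_def)
    obtain a where "a \<notin> Z" using \<open>Z \<noteq> UNIV\<close> by blast
    from closedin_affine_zariski_separate[OF Zcl this] obtain F where
      F: "poly_fun F" "\<And>z. z \<in> Z \<Longrightarrow> F z = 0" "F a \<noteq> 0" by blast
    obtain P where P: "\<And>z. F z = ?ev P z" using poly_fun_bivariate[OF F(1) ij] by blast
    obtain b where "b \<in> Z" "b \<notin> W" using W(2) by blast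
    from closedin_affine_zariski_separate[OF W(1) this(2)] obtain G where
      G: "poly_fun G" "\<And>z. z \<in> W \<Longrightarrow> G z = 0" "G b \<noteq> 0" by blast
    obtain Q where Q: "\<And>z. G z = ?ev Q z" using poly_fun_bivariate[OF G(1) ij] by blast
    \<comment> \<open>The constants of the polynomial ring are here the polynomials in coordinate \<open>i\<close>.\<close>
    have "\<exists>d. d \<noteq> 0 \<and> [:d:] \<in> ?J"
    proof (rule prime_chain_meets_base_ring[of ?I ?J P Q])
      fix A B assume "A * B \<in> ?I"
      then have "Z \<subseteq> {z. ?ev A z = 0} \<union> {z. ?ev B z = 0}" by auto
      moreover have "closedin affine_zariski {z. ?ev A z = 0}" "closedin affine_zariski {z. ?ev B z = 0}"
        by (intro closedin_zero_locus poly_fun_of_bivariate)+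
      ultimately have "Z \<subseteq> {z. ?ev A z = 0} \<or> Z \<subseteq> {z. ?ev B z = 0}"
        using irr unfolding irreducible_closedin_def by blast
      then show "A \<in> ?I \<or> B \<in> ?I" by blast
    next
      show "P \<noteq> 0" using F(3) P by auto
      show "P \<in> ?I" using F(2) P by auto
      show "Q \<in> ?J" using G(2) Q by auto
      show "Q \<notin> ?I" using G(3) Q \<open>b \<in> Z\<close> by auto
      show "?I \<subseteq> ?J" using W(2) by blast
    qed auto
    then obtain d where d: "d \<noteq> 0" "\<And>z. z \<in> W \<Longrightarrow> poly d (z $ i) = 0" by auto
    then have "(\<lambda>z. z $ i) ` W \<subseteq> {x. poly d x = 0}" by blast
    then show ?thesis using poly_roots_finite[OF d(1)] finite_subset by blast
  qed
  have "inj_on (\<lambda>z. (z $ 1, z $ 2)) W" by (auto simp: inj_on_def vec_eq_iff forall_2)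
  moreover have "(\<lambda>z. (z $ 1, z $ 2)) ` W \<subseteq> (\<lambda>z. z $ 1) ` W \<times> (\<lambda>z. z $ 2) ` W" by blast
  moreover have "finite ((\<lambda>z. z $ 1) ` W \<times> (\<lambda>z. z $ 2) ` W)"
    using coord_finite[of 1 2] coord_finite[of 2 1] by simp
  ultimately show ?thesis by (meson finite_imageD finite_subset)
qed

text \<open>
  Since \<open>Z2\<close> is not the whole plane, \<open>Z1\<close> is finite, hence a point, and leaves no room for \<open>Z0\<close>.
\<close>

lemma affine_plane_no_long_chain:
  fixes Z0 Z1 Z2 Z3 :: "(complex ^ 2) set"
  assumes irr: "irreducible_closedin affine_zariski Z0" "irreducible_closedin affine_zariski Z1"
      "irreducible_closedin affine_zariski Z2"
    and chain: "Z0 \<subset> Z1" "Z1 \<subset> Z2" "Z2 \<subset> Z3"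
  shows False
proof -
  have "finite Z1"
    using proper_closed_in_curve_finite[OF irr(3) _ _ chain(2)] irr(2) chain(3)
    unfolding irreducible_closedin_def by blast
  then obtain x where "Z1 = {x}"
    using irreducible_finite_singleton[OF irr(2)] closedin_affine_point by blast
  then have "Z0 = {}" using chain(1) by blast
  then show False using irr(1) by (simp add: irreducible_closedin_def)
qed

section \<open>Points, morphisms and charts of a product of projective spaces\<close>

definition proj_pt :: "complex ^ 'n \<Rightarrow> (complex ^ 'n) set" where
  "proj_pt v = proj_rel `` {v}"

lemma mem_proj_pt: "w \<in> proj_pt v \<longleftrightarrow> v \<noteq> 0 \<and> (\<exists>c. c \<noteq> 0 \<and> w = c *s v)"
  by (auto simp: proj_pt_def proj_rel_def)

lemma proj_pt_self: "v \<noteq> 0 \<Longrightarrow> v \<in> proj_pt v"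
  unfolding mem_proj_pt by (intro conjI exI[of _ 1]) auto

lemma proj_pt_nonzero: "w \<in> proj_pt v \<Longrightarrow> w \<noteq> 0"
  by (auto simp: mem_proj_pt)

lemma proj_pt_scale: "c \<noteq> 0 \<Longrightarrow> proj_pt (c *s v) = proj_pt v"
proof (rule Set.set_eqI)
  fix w assume c: "c \<noteq> 0"
  have "(\<exists>b. b \<noteq> 0 \<and> w = (b * c) *s v) \<longleftrightarrow> (\<exists>b. b \<noteq> 0 \<and> w = b *s v)"
  proof
    assume "\<exists>b. b \<noteq> 0 \<and> w = b *s v"
    then obtain b where "b \<noteq> 0" "w = b *s v" by blast
    then show "\<exists>b. b \<noteq> 0 \<and> w = (b * c) *s v" using c by (intro exI[of _ "b / c"]) auto
  qed (use c in \<open>metis mult_eq_0_iff\<close>)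
  then show "w \<in> proj_pt (c *s v) \<longleftrightarrow> w \<in> proj_pt v" using c by (auto simp: mem_proj_pt)
qed

lemma proj_pt_eqI: "w \<in> proj_pt v \<Longrightarrow> proj_pt v = proj_pt w"
  by (auto simp: mem_proj_pt proj_pt_scale)

lemma proj_pt_in_proj_points: "v \<noteq> 0 \<Longrightarrow> proj_pt v \<in> proj_points"
  by (auto simp: proj_pt_def proj_points_def quotient_def)

lemma proj_points_cases:
  assumes "L \<in> proj_points"
  obtains v where "v \<noteq> 0" "L = proj_pt v"
  using assms by (auto simp: proj_pt_def proj_points_def quotient_def)

lemma proj_pt_eqD: "proj_pt v = proj_pt w \<Longrightarrow> w \<noteq> 0 \<Longrightarrow> \<exists>c. c \<noteq> 0 \<and> w = c *s v"
  using proj_pt_self[of w] mem_proj_pt[of w v] by auto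

lemma mem_biproj_nonzero:
  assumes "\<And>F. F \<in> S \<Longrightarrow> \<exists>d e. bihom d e F" "v \<noteq> 0" "w \<noteq> 0"
  shows "(proj_pt v, proj_pt w) \<in> biproj_nonzero S \<longleftrightarrow> (\<exists>F\<in>S. F v w \<noteq> 0)"
proof -
  have "(\<forall>v'\<in>proj_pt v. \<forall>w'\<in>proj_pt w. F v' w' = 0) \<longleftrightarrow> F v w = 0" if F: "F \<in> S" for F
  proof -
    obtain d e where "bihom d e F" using assms(1)[OF F] by blast
    from bihom_zero_iff[OF this proj_pt_in_proj_points[OF assms(2)] proj_pt_in_proj_points[OF assms(3)]]
    show ?thesis using proj_pt_self[OF assms(2)] proj_pt_self[OF assms(3)] by blast
  qed
  then show ?thesis
    unfolding biproj_nonzero_def using assms(2,3) by (auto simp: proj_pt_in_proj_points)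
qed

lemma mem_biproj_nonzero_single:
  assumes "bihom d e F" "v \<noteq> 0" "w \<noteq> 0"
  shows "(proj_pt v, proj_pt w) \<in> biproj_nonzero {F} \<longleftrightarrow> F v w \<noteq> 0"
proof -
  have "\<And>G. G \<in> {F} \<Longrightarrow> \<exists>d e. bihom d e G" using assms(1) by auto
  from mem_biproj_nonzero[of "{F}", OF this assms(2,3)] show ?thesis by simp
qed

lemma openin_biproj_nonzero_single: "bihom d e F \<Longrightarrow> openin biproj_zariski (biproj_nonzero {F})"
  unfolding openin_biproj_zariski by (intro exI[of _ "{F}"]) auto

lemma topspace_biproj_zariski [simp]:
  "topspace biproj_zariski = (proj_points \<times> proj_points :: ((complex ^ 'm) set \<times> (complex ^ 'n) set) set)"
proof -
  have "biproj_nonzero {\<lambda>_ _. 1} = (proj_points \<times> proj_points :: ((complex ^ 'm) set \<times> (complex ^ 'n) set) set)"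
  proof
    show "biproj_nonzero {\<lambda>_ _. 1} \<subseteq> (proj_points \<times> proj_points :: ((complex ^ 'm) set \<times> (complex ^ 'n) set) set)"
      unfolding biproj_nonzero_def by (rule Diff_subset)
    show "proj_points \<times> proj_points \<subseteq> (biproj_nonzero {\<lambda>_ _. 1} :: ((complex ^ 'm) set \<times> (complex ^ 'n) set) set)"
    proof clarify
      fix L :: "(complex ^ 'm) set" and M :: "(complex ^ 'n) set"
      assume "L \<in> proj_points" "M \<in> proj_points"
      then obtain v w where "v \<noteq> 0" "L = proj_pt v" "w \<noteq> 0" "M = proj_pt w" by (metis proj_points_cases)
      then show "(L, M) \<in> biproj_nonzero {\<lambda>_ _. 1}"
        using mem_biproj_nonzero_single[OF bihom.const[of 1], of v w] by simp
    qed
  qed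
  then have "openin biproj_zariski (proj_points \<times> proj_points :: ((complex ^ 'm) set \<times> (complex ^ 'n) set) set)"
    using openin_biproj_nonzero_single[OF bihom.const[of 1]] by metis
  moreover have "U \<subseteq> proj_points \<times> proj_points" if "openin biproj_zariski U"
    for U :: "((complex ^ 'm) set \<times> (complex ^ 'n) set) set"
    using that unfolding openin_biproj_zariski biproj_nonzero_def by (elim exE conjE) simp
  ultimately show ?thesis unfolding topspace_def by blast
qed

lemma biproj_points_cases:
  assumes "p \<in> topspace biproj_zariski"
  obtains v w where "v \<noteq> 0" "w \<noteq> 0" "p = (proj_pt v, proj_pt w)"
  using assms by (auto elim!: proj_points_cases)

lemma poly_fun_of_bihom:
  assumes "bihom d e F" "\<And>i. poly_fun (\<lambda>z. g z $ i)" "\<And>j. poly_fun (\<lambda>z. h z $ j)"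
  shows "poly_fun (\<lambda>z. F (g z) (h z))"
  using assms(1)
proof induction
  case const show ?case by (rule poly_fun.const)
next
  case coord1 show ?case by (rule assms(2))
next
  case coord2 show ?case by (rule assms(3))
next
  case add then show ?case by (intro poly_fun.add)
next
  case mult then show ?case by (intro poly_fun.mult)
qed

lemma
  fixes g :: "complex ^ 'k \<Rightarrow> complex ^ 'm" and h :: "complex ^ 'k \<Rightarrow> complex ^ 'n"
  assumes poly: "\<And>i. poly_fun (\<lambda>z. g z $ i)" "\<And>j. poly_fun (\<lambda>z. h z $ j)"
    and nz: "\<And>z. g z \<noteq> 0" "\<And>z. h z \<noteq> 0"
  shows continuous_to_biproj: "continuous_map affine_zariski biproj_zariski (\<lambda>z. (proj_pt (g z), proj_pt (h z)))"
    and morphism_to_biproj: "morphism affine_space biproj (\<lambda>z. (proj_pt (g z), proj_pt (h z)))"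
proof -
  let ?f = "\<lambda>z. (proj_pt (g z), proj_pt (h z))"
  show cont: "continuous_map affine_zariski biproj_zariski ?f"
    unfolding continuous_map
  proof (intro conjI allI impI)
    show "?f ` topspace affine_zariski \<subseteq> topspace biproj_zariski"
      using nz by (auto intro: proj_pt_in_proj_points)
  next
    fix U :: "((complex ^ 'm) set \<times> (complex ^ 'n) set) set" assume "openin biproj_zariski U"
    then obtain S where S: "\<forall>F\<in>S. \<exists>d e. bihom d e F" "U = biproj_nonzero S"
      unfolding openin_biproj_zariski by blast
    have "{z \<in> topspace affine_zariski. ?f z \<in> U} = - {z. \<forall>F\<in>(\<lambda>F z. F (g z) (h z)) ` S. F z = 0}"
      using mem_biproj_nonzero[of S "g _" "h _"] S nz by auto
    moreover have "\<forall>F\<in>(\<lambda>F z. F (g z) (h z)) ` S. poly_fun F"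
      using S(1) poly_fun_of_bihom[OF _ poly] by blast
    ultimately show "openin affine_zariski {z \<in> topspace affine_zariski. ?f z \<in> U}"
      unfolding openin_affine_zariski by blast
  qed
  show "morphism affine_space biproj ?f"
    unfolding morphism_def affine_space_def biproj_def variety.simps
  proof (intro conjI allI impI cont)
    fix V :: "((complex ^ 'm) set \<times> (complex ^ 'n) set) set" and \<phi>
    assume "openin biproj_zariski V" and reg: "biproj_regular V \<phi>"
    show "affine_regular {x \<in> topspace affine_zariski. ?f x \<in> V} (\<lambda>x. \<phi> (?f x))"
      unfolding affine_regular_def
    proof
      fix x assume "x \<in> {x \<in> topspace affine_zariski. ?f x \<in> V}"
      then have "?f x \<in> V" by simp
      then have "\<exists>W d e G H. openin biproj_zariski W \<and> ?f x \<in> W \<and> W \<subseteq> V \<and> bihom d e G \<and> bihom d e H \<and>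
        (\<forall>(L, M)\<in>W. \<forall>v\<in>L. \<forall>w\<in>M. H v w \<noteq> 0 \<and> \<phi> (L, M) = G v w / H v w)"
        using reg unfolding biproj_regular_def by (rule bspec[rotated])
      then obtain W d e G H where W: "openin biproj_zariski W" "?f x \<in> W" "W \<subseteq> V"
        "bihom d e G" "bihom d e H"
        "\<forall>(L, M)\<in>W. \<forall>v\<in>L. \<forall>w\<in>M. H v w \<noteq> 0 \<and> \<phi> (L, M) = G v w / H v w"
        by blast
      have "openin affine_zariski {z \<in> topspace affine_zariski. ?f z \<in> W}"
        using cont W(1) by (rule openin_continuous_map_preimage)
      moreover have "\<forall>y\<in>{z \<in> topspace affine_zariski. ?f z \<in> W}.
          H (g y) (h y) \<noteq> 0 \<and> \<phi> (?f y) = G (g y) (h y) / H (g y) (h y)"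
        using W(6) proj_pt_self[OF nz(1)] proj_pt_self[OF nz(2)] by fastforce
      ultimately show "\<exists>V' G H. openin affine_zariski V' \<and> x \<in> V' \<and>
          V' \<subseteq> {x \<in> topspace affine_zariski. ?f x \<in> V} \<and> poly_fun G \<and> poly_fun H \<and>
          (\<forall>y\<in>V'. H y \<noteq> 0 \<and> \<phi> (?f y) = G y / H y)"
        using W(2,3) poly_fun_of_bihom[OF W(4) poly] poly_fun_of_bihom[OF W(5) poly]
        by (intro exI[of _ "{z \<in> topspace affine_zariski. ?f z \<in> W}"]
            exI[of _ "\<lambda>z. G (g z) (h z)"] exI[of _ "\<lambda>z. H (g z) (h z)"]) auto
    qed
  qed
qed

text \<open>
  Homogeneous coordinates of the point with affine coordinate \<open>s\<close> in the chart where the \<open>i\<close>-th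
  homogeneous coordinate is nonzero.
\<close>

definition affine_vector :: "2 \<Rightarrow> complex \<Rightarrow> complex ^ 2" where
  "affine_vector i s = (\<chi> k. if k = i then 1 else s)"

lemma affine_vector_nonzero: "affine_vector i s \<noteq> 0"
  by (auto simp: affine_vector_def vec_eq_iff intro!: exI[of _ i])

lemma affine_vector_same [simp]: "affine_vector i s $ i = 1"
  by (simp add: affine_vector_def)

lemma affine_vector_other: "k \<noteq> i \<Longrightarrow> affine_vector i s $ k = s"
  by (simp add: affine_vector_def)

lemma exists_other_index: "\<exists>k. k \<noteq> (i :: 2)"
  using exhaust_2[of i] by (metis one_neq_zero zero_neq_one numeral_2_eq_2 of_nat_0 zero_neq_numeral num1_eq1)

lemma eq_scale_affine_vector:
  fixes v :: "complex ^ 2"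
  assumes "v $ i \<noteq> 0" "k \<noteq> i"
  shows "v = v $ i *s affine_vector i (v $ k / v $ i)"
proof -
  have "l = i \<or> l = k" for l
    using exhaust_2[of i] exhaust_2[of k] exhaust_2[of l] assms(2) by auto
  then show ?thesis using assms by (auto simp: vec_eq_iff affine_vector_def)
qed

definition chart :: "2 \<Rightarrow> 2 \<Rightarrow> complex ^ 2 \<Rightarrow> (complex ^ 2) set \<times> (complex ^ 2) set" where
  "chart i j z = (proj_pt (affine_vector i (z $ 1)), proj_pt (affine_vector j (z $ 2)))"

text \<open>
  Multiplication by powers of one coordinate of each factor does not change the values at vectors
  normalized to have these coordinates equal to 1; it serves to bring forms to a common bidegree.
\<close>

lemma bihom_raise_degree:
  assumes "bihom d e P" "d \<le> d'" "e \<le> e'"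
  shows "bihom d' e' (\<lambda>v w. P v w * ((v $ i) ^ (d' - d) * (w $ j) ^ (e' - e)))"
proof -
  have v: "bihom k 0 (\<lambda>v w. (v $ i) ^ k)" for k
  proof (induction k)
    case (Suc k)
    show ?case using bihom.mult[OF bihom.coord1 Suc, of i] by simp
  qed (simp add: bihom.const)
  have w: "bihom 0 k (\<lambda>v w. (w $ j) ^ k)" for k
  proof (induction k)
    case (Suc k)
    show ?case using bihom.mult[OF bihom.coord2 Suc, of j] by simp
  qed (simp add: bihom.const)
  show ?thesis
    using bihom.mult[OF assms(1) bihom.mult[OF v[of "d' - d"] w[of "e' - e"]]] assms(2,3) by simp
qed

text \<open>
  Every polynomial on a chart is the restriction of a bihomogeneous form, so that closed sets and
  functions can be moved from the chart to the product.
\<close>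

lemma homogenization:
  fixes p :: "complex ^ 2 \<Rightarrow> complex"
  assumes "poly_fun p"
  shows "\<exists>d e P. bihom d e P \<and> (\<forall>z. P (affine_vector i (z $ 1)) (affine_vector j (z $ 2)) = p z)"
  using assms
proof induction
  case (const c)
  show ?case by (intro exI conjI, rule bihom.const[of c]) simp
next
  case (coord l)
  obtain k where k: "k \<noteq> i" using exists_other_index by blast
  obtain m where m: "m \<noteq> j" using exists_other_index by blast
  consider "l = 1" | "l = 2" using exhaust_2 by blast
  then show ?case
  proof cases
    case 1
    show ?thesis
      by (intro exI conjI, rule bihom.coord1[of k]) (simp add: 1 affine_vector_other[OF k])
  next
    case 2
    show ?thesis
      by (intro exI conjI, rule bihom.coord2[of m]) (simp add: 2 affine_vector_other[OF m])
  qed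
next
  case (add F G)
  obtain d e P where P: "bihom d e P" "\<And>z. P (affine_vector i (z $ 1)) (affine_vector j (z $ 2)) = F z"
    using add.IH(1) by blast
  obtain d' e' Q where Q: "bihom d' e' Q" "\<And>z. Q (affine_vector i (z $ 1)) (affine_vector j (z $ 2)) = G z"
    using add.IH(2) by blast
  show ?case
    by (intro exI conjI, rule bihom.add[OF
          bihom_raise_degree[OF P(1), of "max d d'" "max e e'" i j]
          bihom_raise_degree[OF Q(1), of "max d d'" "max e e'" i j]])
       (simp_all add: P(2) Q(2))
next
  case (mult F G)
  obtain d e P where P: "bihom d e P" "\<And>z. P (affine_vector i (z $ 1)) (affine_vector j (z $ 2)) = F z"
    using mult.IH(1) by blast
  obtain d' e' Q where Q: "bihom d' e' Q" "\<And>z. Q (affine_vector i (z $ 1)) (affine_vector j (z $ 2)) = G z"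
    using mult.IH(2) by blast
  show ?case
    by (intro exI conjI, rule bihom.mult[OF P(1) Q(1)]) (simp add: P(2) Q(2))
qed

lemma continuous_chart: "continuous_map affine_zariski biproj_zariski (chart i j)"
proof -
  have "poly_fun (\<lambda>z. affine_vector i (z $ l) $ k)" for i l k :: 2
    by (cases "k = i") (simp_all add: affine_vector_def poly_fun.const poly_fun.coord)
  then show ?thesis
    unfolding chart_def by (intro continuous_to_biproj affine_vector_nonzero)
qed

lemma inj_chart: "inj (chart i j)"
proof (rule injI)
  fix z z' assume "chart i j z = chart i j z'"
  then have *: "proj_pt (affine_vector i (z $ 1)) = proj_pt (affine_vector i (z' $ 1))" "proj_pt (affine_vector j (z $ 2)) = proj_pt (affine_vector j (z' $ 2))"
    by (auto simp: chart_def)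
  have "s = t" if eq: "proj_pt (affine_vector i s) = proj_pt (affine_vector i t)" for i s t
  proof -
    obtain c where c: "affine_vector i t = c *s affine_vector i s" using proj_pt_eqD[OF eq affine_vector_nonzero] by blast
    have "c = 1" using arg_cong[OF c, of "\<lambda>v. v $ i"] by simp
    moreover obtain k where "k \<noteq> i" using exists_other_index by blast
    ultimately show ?thesis using arg_cong[OF c, of "\<lambda>v. v $ k"] by (simp add: affine_vector_other)
  qed
  from this[OF *(1)] this[OF *(2)] show "z = z'" by (simp add: vec_eq_iff forall_2)
qed

text \<open>
  Around a point where the polynomial \<open>F\<close> is nonzero, the image contains the locus where the
  homogenization of \<open>F\<close> and the two coordinates that define the chart are all nonzero.
\<close>

lemma open_map_chart: "open_map affine_zariski biproj_zariski (chart i j)"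
  unfolding open_map_def
proof (intro allI impI)
  fix U :: "(complex ^ 2) set" assume U: "openin affine_zariski U"
  show "openin biproj_zariski (chart i j ` U)"
  proof (subst openin_subopen, intro ballI)
    fix p assume "p \<in> chart i j ` U"
    then obtain z where z: "z \<in> U" "p = chart i j z" by blast
    obtain F where F: "poly_fun F" "F z \<noteq> 0" "\<And>y. F y \<noteq> 0 \<Longrightarrow> y \<in> U"
      using openin_affine_zariski_basic[OF U z(1)] by blast
    obtain d e P where P: "bihom d e P" "\<And>z. P (affine_vector i (z $ 1)) (affine_vector j (z $ 2)) = F z"
      using homogenization[OF F(1)] by blast
    let ?Q = "\<lambda>v w. P v w * (v $ i * w $ j)"
    have Q: "bihom (Suc d) (Suc e) ?Q"
      using bihom_raise_degree[OF P(1), of "Suc d" "Suc e" i j] by simp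
    have "p \<in> biproj_nonzero {?Q}"
      unfolding z(2) chart_def using mem_biproj_nonzero_single[OF Q affine_vector_nonzero affine_vector_nonzero] P(2) F(2)
      by simp
    moreover have "biproj_nonzero {?Q} \<subseteq> chart i j ` U"
    proof
      fix q assume q: "q \<in> biproj_nonzero {?Q}"
      then have "q \<in> topspace biproj_zariski" by (auto simp: biproj_nonzero_def)
      then obtain v w where vw: "v \<noteq> 0" "w \<noteq> 0" "q = (proj_pt v, proj_pt w)"
        by (rule biproj_points_cases)
      then have nz: "P v w \<noteq> 0" "v $ i \<noteq> 0" "w $ j \<noteq> 0"
        using mem_biproj_nonzero_single[OF Q vw(1,2)] q by auto
      obtain k where k: "k \<noteq> i" using exists_other_index by blast
      obtain m where m: "m \<noteq> j" using exists_other_index by blast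
      define y :: "complex ^ 2" where "y = vector [v $ k / v $ i, w $ m / w $ j]"
      have y: "v = v $ i *s affine_vector i (y $ 1)" "w = w $ j *s affine_vector j (y $ 2)"
        using eq_scale_affine_vector[OF nz(2) k] eq_scale_affine_vector[OF nz(3) m] by (simp_all add: y_def)
      have "P v w = (v $ i) ^ d * (w $ j) ^ e * F y"
        using bihom_scale[OF P(1), of "v $ i" "affine_vector i (y $ 1)" "w $ j" "affine_vector j (y $ 2)"]
        unfolding y[symmetric] P(2) .
      then have "y \<in> U" using nz(1) F(3) by auto
      moreover have "q = chart i j y"
        unfolding vw(3) chart_def using proj_pt_scale[OF nz(2), of "affine_vector i (y $ 1)"]
          proj_pt_scale[OF nz(3), of "affine_vector j (y $ 2)"] y by simp
      ultimately show "q \<in> chart i j ` U" by blast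
    qed
    ultimately show "\<exists>T. openin biproj_zariski T \<and> p \<in> T \<and> T \<subseteq> chart i j ` U"
      using openin_biproj_nonzero_single[OF Q] by blast
  qed
qed

lemma point_in_chart:
  assumes "p \<in> topspace biproj_zariski"
  shows "\<exists>i j. p \<in> range (chart i j)"
proof -
  obtain v w where vw: "v \<noteq> 0" "w \<noteq> 0" "p = (proj_pt v, proj_pt w)"
    using assms by (rule biproj_points_cases)
  obtain i j where ij: "v $ i \<noteq> 0" "w $ j \<noteq> 0" using vw(1,2) by (auto simp: vec_eq_iff)
  obtain k where k: "k \<noteq> i" using exists_other_index by blast
  obtain m where m: "m \<noteq> j" using exists_other_index by blast
  have "p = chart i j (vector [v $ k / v $ i, w $ m / w $ j])"
    unfolding vw(3) chart_def using eq_scale_affine_vector[OF ij(1) k] eq_scale_affine_vector[OF ij(2) m]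
      proj_pt_scale[OF ij(1), of "affine_vector i (v $ k / v $ i)"] proj_pt_scale[OF ij(2), of "affine_vector j (w $ m / w $ j)"]
    by simp
  then show ?thesis by blast
qed

text \<open>
  Up to homeomorphism this is the intersection of an irreducible closed set with an open subset that
  it meets.
\<close>

lemma irreducible_closedin_open_preimage:
  assumes c: "continuous_map T T' c" "open_map T T' c" "inj_on c (topspace T)"
    and irr: "irreducible_closedin T' Z" and meets: "Z \<inter> c ` topspace T \<noteq> {}"
  shows "irreducible_closedin T {x \<in> topspace T. c x \<in> Z}"
proof -
  have Z: "closedin T' Z" using irr by (simp add: irreducible_closedin_def)
  have sub: "c ` topspace T \<subseteq> topspace T'" using c(1) by (rule continuous_map_image_subset_topspace)
  \<comment> \<open>Every closed set of \<open>T\<close> is the trace of a closed set of \<open>T'\<close> that contains the complement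
    of the open image.\<close>
  let ?E = "\<lambda>A. topspace T' - c ` (topspace T - A)"
  have E: "closedin T' (?E A)" if "closedin T A" for A
    using c(2) that by (meson closedin_def closedin_diff closedin_topspace open_map_def)
  have trace: "c x \<in> ?E A \<longleftrightarrow> x \<in> A" if "x \<in> topspace T" for x A
    using that c(3) sub unfolding inj_on_def by blast
  show ?thesis
    unfolding irreducible_closedin_def
  proof (intro conjI allI impI)
    show "closedin T {x \<in> topspace T. c x \<in> Z}"
      using c(1) Z by (rule closedin_continuous_map_preimage)
    show "{x \<in> topspace T. c x \<in> Z} \<noteq> {}" using meets by blast
  next
    fix A B
    assume AB: "closedin T A" "closedin T B" "{x \<in> topspace T. c x \<in> Z} \<subseteq> A \<union> B"
    have "Z \<subseteq> topspace T'" using Z by (rule closedin_subset)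
    have "Z \<subseteq> ?E A \<union> ?E B"
    proof
      fix p assume p: "p \<in> Z"
      show "p \<in> ?E A \<union> ?E B"
      proof (cases "p \<in> c ` topspace T")
        case True
        then obtain x where x: "x \<in> topspace T" "p = c x" by blast
        then have "x \<in> A \<or> x \<in> B" using AB(3) p by blast
        then have "c x \<in> ?E A \<or> c x \<in> ?E B"
          unfolding trace[OF x(1)] .
        then show ?thesis unfolding x(2) by (simp only: Un_iff)
      next
        case False
        then show ?thesis using p \<open>Z \<subseteq> topspace T'\<close> by blast
      qed
    qed
    then have "Z \<subseteq> ?E A \<or> Z \<subseteq> ?E B"
      using irr E[OF AB(1)] E[OF AB(2)] unfolding irreducible_closedin_def by blast
    moreover have "{x \<in> topspace T. c x \<in> Z} \<subseteq> A'" if "Z \<subseteq> ?E A'" for A'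
    proof clarify
      fix x assume x: "x \<in> topspace T" "c x \<in> Z"
      then have "c x \<in> ?E A'" using that by (rule_tac subsetD)
      then show "x \<in> A'" unfolding trace[OF x(1)] .
    qed
    ultimately show "{x \<in> topspace T. c x \<in> Z} \<subseteq> A \<or> {x \<in> topspace T. c x \<in> Z} \<subseteq> B"
      by metis
  qed
qed

text \<open>
  A nonempty open part of an irreducible closed set is dense in it, so strict inclusions survive
  passing to an open set.
\<close>

lemma irreducible_open_preimage_mono:
  assumes "open_map T T' c" "irreducible_closedin T' Z'" "closedin T' Z"
    and "Z' \<inter> c ` topspace T \<noteq> {}"
    and "{x \<in> topspace T. c x \<in> Z'} \<subseteq> {x \<in> topspace T. c x \<in> Z}"
  shows "Z' \<subseteq> Z"
proof -
  have "closedin T' (topspace T' - c ` topspace T)"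
    using assms(1) by (meson closedin_def closedin_diff closedin_topspace open_map_def openin_topspace)
  moreover have "Z' \<subseteq> Z \<union> (topspace T' - c ` topspace T)"
    using assms(2,5) closedin_subset[of T' Z'] unfolding irreducible_closedin_def by blast
  ultimately have "Z' \<subseteq> Z \<or> Z' \<subseteq> topspace T' - c ` topspace T"
    using assms(2,3) unfolding irreducible_closedin_def by blast
  then show ?thesis using assms(4) by blast
qed

text \<open>
  All members of the chain contain a point of the smallest one, hence meet one and the same chart,
  and the chain restricts to a strict chain of irreducible closed sets in the affine plane.
\<close>

lemma P1_times_P1_no_long_chain:
  fixes Z :: "nat \<Rightarrow> ((complex ^ 2) set \<times> (complex ^ 2) set) set"
  assumes irr: "\<And>i. i \<le> 3 \<Longrightarrow> irreducible_closedin biproj_zariski (Z i)"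
    and chain: "\<And>i. i < 3 \<Longrightarrow> Z i \<subset> Z (Suc i)"
  shows False
proof -
  obtain p where p: "p \<in> Z 0" using irr[of 0] by (auto simp: irreducible_closedin_def)
  then have "p \<in> topspace biproj_zariski"
    using irr[of 0] closedin_subset unfolding irreducible_closedin_def by blast
  then obtain i j where ij: "p \<in> range (chart i j)" using point_in_chart by blast
  have pZ: "p \<in> Z k" if "k \<le> 3" for k
    using that
  proof (induction k)
    case (Suc k)
    then show ?case using chain[of k] by auto
  qed (rule p)
  let ?Y = "\<lambda>k. {x \<in> topspace affine_zariski. chart i j x \<in> Z k}"
  have Y: "irreducible_closedin affine_zariski (?Y k)" if "k \<le> 3" for k
    using irreducible_closedin_open_preimage[OF continuous_chart open_map_chart, of i j "Z k"]
      inj_chart irr[OF that] pZ[OF that] ij by auto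
  have Y_strict: "?Y k \<subset> ?Y (Suc k)" if "k < 3" for k
  proof -
    have "\<not> ?Y (Suc k) \<subseteq> ?Y k"
    proof
      assume "?Y (Suc k) \<subseteq> ?Y k"
      then have "Z (Suc k) \<subseteq> Z k"
        using irreducible_open_preimage_mono[OF open_map_chart irr[of "Suc k"], of "Z k" i j]
          irr[of k] pZ[of "Suc k"] ij that by (auto simp: irreducible_closedin_def)
      then show False using chain[OF that] by blast
    qed
    then show ?thesis using chain[OF that] by blast
  qed
  show False
    using affine_plane_no_long_chain[OF Y[of 0] Y[of 1] Y[of 2]]
      Y_strict[of 0] Y_strict[of 1] Y_strict[of 2] by (simp add: numeral_2_eq_2 numeral_3_eq_3)
qed

lemma krull_dim_eqI:
  assumes "\<And>i. i \<le> n \<Longrightarrow> irreducible_closedin T (Z i)" "\<And>i. i < n \<Longrightarrow> Z i \<subset> Z (Suc i)"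
    and no_long: "\<And>Y. (\<And>i. i \<le> Suc n \<Longrightarrow> irreducible_closedin T (Y i)) \<Longrightarrow>
        (\<And>i. i < Suc n \<Longrightarrow> Y i \<subset> Y (Suc i)) \<Longrightarrow> False"
  shows "krull_dim T = enat n"
  unfolding krull_dim_def
proof (rule antisym)
  show "Sup {enat n |n. \<exists>Z. (\<forall>i\<le>n. irreducible_closedin T (Z i)) \<and> (\<forall>i<n. Z i \<subset> Z (Suc i))} \<le> enat n"
  proof (rule Sup_least, clarify)
    fix m Y assume Y: "\<forall>i\<le>m. irreducible_closedin T (Y i)" "\<forall>i<m. Y i \<subset> Y (Suc i)"
    show "enat m \<le> enat n"
    proof (rule ccontr)
      assume "\<not> enat m \<le> enat n"
      then have "Suc n \<le> m" by simp
      then show False using no_long[of Y] Y by simp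
    qed
  qed
  show "enat n \<le> Sup {enat n |n. \<exists>Z. (\<forall>i\<le>n. irreducible_closedin T (Z i)) \<and> (\<forall>i<n. Z i \<subset> Z (Suc i))}"
    using assms(1,2) by (intro Sup_upper) blast
qed

section \<open>The square of the Joukowski map\<close>

text \<open>
  Homogeneous coordinates of \<open>t + 1 / t\<close>, written without denominators; at \<open>t = 0\<close> they give the point
  at infinity.
\<close>

definition joukowski :: "complex \<Rightarrow> complex ^ 2" where
  "joukowski t = vector [t ^ 2 + 1, t]"

definition joukowski_square :: "complex ^ 2 \<Rightarrow> (complex ^ 2) set \<times> (complex ^ 2) set" where
  "joukowski_square z = (proj_pt (joukowski (z $ 1)), proj_pt (joukowski (z $ 2)))"

lemma joukowski_nth [simp]: "joukowski t $ 1 = t ^ 2 + 1" "joukowski t $ 2 = t"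
  by (simp_all add: joukowski_def)

lemma joukowski_nonzero: "joukowski t \<noteq> 0"
proof
  assume "joukowski t = 0"
  then have "joukowski t $ 1 = 0" "joukowski t $ 2 = 0" by simp_all
  then show False by simp
qed

text \<open>
  The point at infinity is the value at 0. If \<open>v\<^sub>2 \<noteq> 0\<close>, the point \<open>v\<close> is reached at a root of
  \<open>v\<^sub>2 t\<^sup>2 - v\<^sub>1 t + v\<^sub>2\<close>; the product of the two roots is 1, so neither of them is 0.
\<close>

lemma joukowski_surj:
  assumes "v \<noteq> 0"
  shows "\<exists>t. proj_pt (joukowski t) = proj_pt v"
proof -
  have "\<exists>t c. c \<noteq> 0 \<and> v = c *s joukowski t"
  proof (cases "v $ 2 = 0")
    case True
    then have "v $ 1 \<noteq> 0" using assms by (auto simp: vec_eq_iff forall_2)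
    then show ?thesis
      using True by (intro exI[of _ 0] exI[of _ "v $ 1"]) (auto simp: vec_eq_iff forall_2)
  next
    case False
    \<comment> \<open>The quadratic formula.\<close>
    define t where "t = (v $ 1 + csqrt ((v $ 1)\<^sup>2 - 4 * (v $ 2)\<^sup>2)) / (2 * v $ 2)"
    have "2 * v $ 2 * t - v $ 1 = csqrt ((v $ 1)\<^sup>2 - 4 * (v $ 2)\<^sup>2)"
      using False by (simp add: t_def)
    then have "(2 * v $ 2 * t - v $ 1)\<^sup>2 = (v $ 1)\<^sup>2 - 4 * (v $ 2)\<^sup>2" by simp
    then have "4 * v $ 2 * (v $ 2 * (t ^ 2 + 1)) = 4 * v $ 2 * (v $ 1 * t)"
      by (simp add: power2_eq_square algebra_simps)
    then have eq: "v $ 2 * (t ^ 2 + 1) = v $ 1 * t" using False by simp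
    then have "t \<noteq> 0" using False by auto
    moreover have "v $ 1 = v $ 2 / t * (t ^ 2 + 1)" using eq \<open>t \<noteq> 0\<close> by (simp add: field_simps)
    ultimately show ?thesis
      using False by (intro exI[of _ t] exI[of _ "v $ 2 / t"]) (auto simp: vec_eq_iff forall_2)
  qed
  then show ?thesis using proj_pt_scale by metis
qed

lemma joukowski_fiber_finite:
  assumes "v \<noteq> 0"
  shows "finite {t. proj_pt (joukowski t) = proj_pt v}"
proof -
  let ?p = "[:v $ 2, - v $ 1, v $ 2:]"
  have "{t. proj_pt (joukowski t) = proj_pt v} \<subseteq> {t. poly ?p t = 0}"
  proof clarify
    fix t assume "proj_pt (joukowski t) = proj_pt v"
    then obtain c where "v = c *s joukowski t" using proj_pt_eqD assms by blast
    then have "v $ 1 = c * (t ^ 2 + 1)" "v $ 2 = c * t" by simp_all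
    then show "poly ?p t = 0" by (simp add: power2_eq_square algebra_simps)
  qed
  moreover have "?p \<noteq> 0" using assms by (auto simp: vec_eq_iff forall_2)
  ultimately show ?thesis using poly_roots_finite finite_subset by blast
qed

lemma poly_fun_joukowski: "poly_fun (\<lambda>z. joukowski (z $ i) $ k)"
proof -
  consider "k = 1" | "k = 2" using exhaust_2 by blast
  then show ?thesis
  proof cases
    case 1
    show ?thesis
      unfolding 1 joukowski_nth
      by (intro poly_fun.add poly_fun_power poly_fun.coord poly_fun.const)
  next
    case 2
    show ?thesis unfolding 2 joukowski_nth by (rule poly_fun.coord)
  qed
qed

lemma continuous_joukowski_square: "continuous_map affine_zariski biproj_zariski joukowski_square"
  unfolding joukowski_square_def
  by (intro continuous_to_biproj joukowski_nonzero poly_fun_joukowski)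

lemma morphism_joukowski_square: "morphism affine_space P1_times_P1 joukowski_square"
  unfolding joukowski_square_def
  by (intro morphism_to_biproj joukowski_nonzero poly_fun_joukowski)

lemma range_joukowski_square: "range joukowski_square = points P1_times_P1"
proof
  show "range joukowski_square \<subseteq> points P1_times_P1"
    by (auto simp: joukowski_square_def biproj_def joukowski_nonzero intro: proj_pt_in_proj_points)
  show "points P1_times_P1 \<subseteq> range joukowski_square"
  proof
    fix p assume "p \<in> points (P1_times_P1)"
    then have "p \<in> topspace biproj_zariski" by (simp add: biproj_def)
    then obtain v w where vw: "v \<noteq> 0" "w \<noteq> 0" "p = (proj_pt v, proj_pt w)" by (rule biproj_points_cases)
    obtain s t where "proj_pt (joukowski s) = proj_pt v" "proj_pt (joukowski t) = proj_pt w"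
      using joukowski_surj[OF vw(1)] joukowski_surj[OF vw(2)] by auto
    then have "p = joukowski_square (vector [s, t])" using vw(3) by (simp add: joukowski_square_def)
    then show "p \<in> range joukowski_square" by blast
  qed
qed

lemma finite_fibers_joukowski_square: "finite_fibers P1_times_P1 joukowski_square"
  unfolding finite_fibers_def
proof
  fix p assume "p \<in> points (P1_times_P1)"
  then have "p \<in> topspace biproj_zariski" by (simp add: biproj_def)
  then obtain v w where vw: "v \<noteq> 0" "w \<noteq> 0" "p = (proj_pt v, proj_pt w)" by (rule biproj_points_cases)
  let ?A = "{t. proj_pt (joukowski t) = proj_pt v} \<times> {t. proj_pt (joukowski t) = proj_pt w}"
  have "inj_on (\<lambda>z :: complex ^ 2. (z $ 1, z $ 2)) {z. joukowski_square z = p}"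
    by (auto simp: inj_on_def vec_eq_iff forall_2)
  moreover have "(\<lambda>z :: complex ^ 2. (z $ 1, z $ 2)) ` {z. joukowski_square z = p} \<subseteq> ?A"
    by (auto simp: joukowski_square_def vw(3))
  moreover have "finite ?A" using joukowski_fiber_finite vw(1,2) by blast
  ultimately show "finite {z. joukowski_square z = p}" by (meson finite_imageD finite_subset)
qed

lemma closedin_biproj:
  assumes "\<And>F. F \<in> S \<Longrightarrow> \<exists>d e. bihom d e F"
  shows "closedin biproj_zariski (topspace biproj_zariski - biproj_nonzero S)"
  using assms by (intro closedin_diff closedin_topspace) (auto simp: openin_biproj_zariski)

text \<open>
  The chain is a point, the fiber \<open>{\<infinity>} \<times> \<bbbP>\<^sup>1\<close> through it, and the whole surface.
\<close>

lemma krull_dim_P1_times_P1: "krull_dim (zariski P1_times_P1) = enat CARD(2)"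
proof -
  let ?T = "biproj_zariski :: ((complex ^ 2) set \<times> (complex ^ 2) set) topology"
  let ?o = "proj_pt (joukowski 0)"
  let ?Z = "\<lambda>k :: nat. if k = 0 then {(?o, ?o)} else if k = 1 then {?o} \<times> proj_points else topspace ?T"
  have origin: "proj_pt v = ?o \<longleftrightarrow> v $ 2 = 0" if "v \<noteq> 0" for v
  proof
    assume "proj_pt v = ?o"
    then have "proj_pt (joukowski 0) = proj_pt v" by simp
    from proj_pt_eqD[OF this that] obtain c where "v = c *s joukowski 0" by auto
    then show "v $ 2 = 0" by simp
  next
    assume "v $ 2 = 0"
    then have "v = v $ 1 *s joukowski 0" "v $ 1 \<noteq> 0" using that by (auto simp: vec_eq_iff forall_2)
    then show "proj_pt v = ?o" using proj_pt_scale by metis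
  qed
  have second: "bihom 0 1 (\<lambda>(_ :: complex ^ 2) w :: complex ^ 2. w $ 2)" by (rule bihom.coord2)
  have first: "bihom 1 0 (\<lambda>(v :: complex ^ 2) (_ :: complex ^ 2). v $ 2)" by (rule bihom.coord1)
  have Z1_closed: "closedin ?T ({?o} \<times> proj_points)"
  proof -
    have "{?o} \<times> proj_points = topspace ?T - biproj_nonzero {\<lambda>v _. v $ 2}"
    proof (rule Set.set_eqI)
      fix p :: "(complex ^ 2) set \<times> (complex ^ 2) set"
      show "p \<in> {?o} \<times> proj_points \<longleftrightarrow> p \<in> topspace ?T - biproj_nonzero {\<lambda>v _. v $ 2}"
      proof (cases "p \<in> topspace ?T")
        case True
        then obtain v w where "v \<noteq> 0" "w \<noteq> 0" "p = (proj_pt v, proj_pt w)" by (rule biproj_points_cases)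
        then show ?thesis
          using mem_biproj_nonzero_single[OF first, of v w] origin[of v] True by simp
      qed (auto intro: proj_pt_in_proj_points[OF joukowski_nonzero])
    qed
    then show ?thesis using closedin_biproj[of "{\<lambda>v _. v $ 2}"] first by force
  qed
  have Z1'_closed: "closedin ?T (proj_points \<times> {?o})"
  proof -
    have "proj_points \<times> {?o} = topspace ?T - biproj_nonzero {\<lambda>_ w. w $ 2}"
    proof (rule Set.set_eqI)
      fix p :: "(complex ^ 2) set \<times> (complex ^ 2) set"
      show "p \<in> proj_points \<times> {?o} \<longleftrightarrow> p \<in> topspace ?T - biproj_nonzero {\<lambda>_ w. w $ 2}"
      proof (cases "p \<in> topspace ?T")
        case True
        then obtain v w where "v \<noteq> 0" "w \<noteq> 0" "p = (proj_pt v, proj_pt w)" by (rule biproj_points_cases)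
        then show ?thesis
          using mem_biproj_nonzero_single[OF second, of v w] origin[of w] True by simp
      qed (auto intro: proj_pt_in_proj_points[OF joukowski_nonzero])
    qed
    then show ?thesis using closedin_biproj[of "{\<lambda>_ w. w $ 2}"] second by force
  qed
  have Z0_closed: "closedin ?T {(?o, ?o)}"
  proof -
    have "{(?o, ?o)} = ({?o} \<times> proj_points) \<inter> (proj_points \<times> {?o})"
      using proj_pt_in_proj_points[OF joukowski_nonzero] by blast
    then show ?thesis using closedin_Int[OF Z1_closed Z1'_closed] by simp
  qed
  \<comment> \<open>Each member of the chain is the image of an affine subspace of the plane.\<close>
  have image: "irreducible_closedin ?T (joukowski_square ` A)"
    if "closedin affine_zariski A" "A \<noteq> {}" "\<And>a b t. a \<in> A \<Longrightarrow> b \<in> A \<Longrightarrow> a + t *s (b - a) \<in> A"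
      "closedin ?T (joukowski_square ` A)" for A
    using that
    by (intro irreducible_closedin_image[OF _ continuous_joukowski_square] irreducible_affine_subspace)
  have im0: "joukowski_square ` {0} = {(?o, ?o)}" by (simp add: joukowski_square_def)
  have im1: "joukowski_square ` {z. z $ 1 = 0} = {?o} \<times> proj_points"
  proof
    show "joukowski_square ` {z. z $ 1 = 0} \<subseteq> {?o} \<times> proj_points"
      by (auto simp: joukowski_square_def intro: proj_pt_in_proj_points[OF joukowski_nonzero])
    show "{?o} \<times> proj_points \<subseteq> joukowski_square ` {z. z $ 1 = 0}"
    proof clarify
      fix M :: "(complex ^ 2) set" assume "M \<in> proj_points"
      then obtain w where "w \<noteq> 0" "M = proj_pt w" by (rule proj_points_cases)
      then obtain t where "proj_pt (joukowski t) = M" using joukowski_surj by metis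
      then have "(?o, M) = joukowski_square (vector [0, t])" by (simp add: joukowski_square_def)
      then show "(?o, M) \<in> joukowski_square ` {z. z $ 1 = 0}" by force
    qed
  qed
  have im2: "joukowski_square ` UNIV = topspace ?T"
    using range_joukowski_square by (simp add: biproj_def)
  have irr: "irreducible_closedin ?T (?Z k)" if "k \<le> 2" for k
  proof -
    have "irreducible_closedin ?T {(?o, ?o)}"
      using image[of "{0}"] im0 Z0_closed closedin_affine_point[of 0] by simp
    moreover have "irreducible_closedin ?T ({?o} \<times> proj_points)"
    proof -
      have "0 \<in> {z :: complex ^ 2. z $ 1 = 0}" by simp
      then have "{z :: complex ^ 2. z $ 1 = 0} \<noteq> {}" by blast
      then show ?thesis
        using image[of "{z. z $ 1 = 0}"] im1 Z1_closed closedin_zero_locus[OF poly_fun.coord[of 1]]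
        by simp
    qed
    moreover have "irreducible_closedin ?T (topspace ?T)"
      using image[of UNIV] im2 closedin_topspace[of ?T] closedin_topspace[of affine_zariski] by simp
    ultimately show ?thesis by simp
  qed
  have chain: "?Z k \<subset> ?Z (Suc k)" if "k < 2" for k
  proof -
    have o: "?o \<in> proj_points" by (rule proj_pt_in_proj_points[OF joukowski_nonzero])
    have i: "proj_pt (joukowski 1) \<in> proj_points" by (rule proj_pt_in_proj_points[OF joukowski_nonzero])
    have ne: "proj_pt (joukowski 1) \<noteq> ?o" using origin[OF joukowski_nonzero, of 1] by simp
    have strict: "{(a, a)} \<subset> {a} \<times> A" "{a} \<times> A \<subset> A \<times> A"
      if "a \<in> A" "b \<in> A" "b \<noteq> a" for a b :: "(complex ^ 2) set" and A
    proof -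
      have "(a, b) \<in> {a} \<times> A" "(a, b) \<notin> {(a, a)}" "{(a, a)} \<subseteq> {a} \<times> A"
        using that by simp_all
      then show "{(a, a)} \<subset> {a} \<times> A" unfolding psubset_eq by metis
      have "(b, a) \<in> A \<times> A" "(b, a) \<notin> {a} \<times> A" "{a} \<times> A \<subseteq> A \<times> A"
        using that by (simp_all add: Sigma_mono)
      then show "{a} \<times> A \<subset> A \<times> A" unfolding psubset_eq by metis
    qed
    have "{(?o, ?o)} \<subset> {?o} \<times> proj_points" by (rule strict(1)[OF o i ne])
    moreover have "{?o} \<times> proj_points \<subset> topspace ?T"
      unfolding topspace_biproj_zariski by (rule strict(2)[OF o i ne])
    ultimately show ?thesis using that by (cases k) auto
  qed
  have "krull_dim ?T = enat 2"
  proof (rule krull_dim_eqI[of 2 ?T ?Z])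
    fix Y :: "nat \<Rightarrow> ((complex ^ 2) set \<times> (complex ^ 2) set) set"
    assume "\<And>i. i \<le> Suc 2 \<Longrightarrow> irreducible_closedin ?T (Y i)" "\<And>i. i < Suc 2 \<Longrightarrow> Y i \<subset> Y (Suc i)"
    then show False by (intro P1_times_P1_no_long_chain[of Y]) simp_all
  qed (use irr chain in blast)+
  then show ?thesis by (simp add: biproj_def)
qed

lemma pseudo_chart_joukowski_square: "pseudo_chart P1_times_P1 joukowski_square"
  unfolding pseudo_chart_def range_joukowski_square
  using krull_dim_P1_times_P1 morphism_joukowski_square
  by (simp add: subtopology_topspace)

section \<open>The function field of an integral variety\<close>

text \<open>
  The properties of a space with functions that make its rational functions a ring: nonempty
  open sets meet, and a regular function is determined by its values on a nonempty open set.
\<close>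

locale integral_variety =
  fixes X :: "'a variety"
  assumes points_nonempty: "points X \<noteq> {}"
    and opens_meet: "\<And>U V. openin (zariski X) U \<Longrightarrow> openin (zariski X) V \<Longrightarrow>
        U \<noteq> {} \<Longrightarrow> V \<noteq> {} \<Longrightarrow> U \<inter> V \<noteq> {}"
    and regular_const: "\<And>U c. openin (zariski X) U \<Longrightarrow> regular_on X U (\<lambda>_. c)"
    and regular_add: "\<And>U \<phi> \<psi>. regular_on X U \<phi> \<Longrightarrow> regular_on X U \<psi> \<Longrightarrow>
        regular_on X U (\<lambda>x. \<phi> x + \<psi> x)"
    and regular_mult: "\<And>U \<phi> \<psi>. regular_on X U \<phi> \<Longrightarrow> regular_on X U \<psi> \<Longrightarrow>
        regular_on X U (\<lambda>x. \<phi> x * \<psi> x)"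
    and regular_restrict: "\<And>U V \<phi>. regular_on X U \<phi> \<Longrightarrow> openin (zariski X) V \<Longrightarrow> V \<subseteq> U \<Longrightarrow>
        regular_on X V \<phi>"
    and regular_identity: "\<And>U W \<phi> \<psi> x. regular_on X U \<phi> \<Longrightarrow> regular_on X U \<psi> \<Longrightarrow>
        openin (zariski X) U \<Longrightarrow> openin (zariski X) W \<Longrightarrow> W \<noteq> {} \<Longrightarrow> W \<subseteq> U \<Longrightarrow>
        (\<And>y. y \<in> W \<Longrightarrow> \<phi> y = \<psi> y) \<Longrightarrow> x \<in> U \<Longrightarrow> \<phi> x = \<psi> x"
begin

abbreviation rep :: "'a set \<Rightarrow> ('a \<Rightarrow> complex) \<Rightarrow> bool" where
  "rep U \<phi> \<equiv> (U, \<phi>) \<in> rational_reps X"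

abbreviation cls :: "'a set \<Rightarrow> ('a \<Rightarrow> complex) \<Rightarrow> ('a set \<times> ('a \<Rightarrow> complex)) set" where
  "cls \<equiv> rational_class X"

lemma rep_iff: "rep U \<phi> \<longleftrightarrow> openin (zariski X) U \<and> U \<noteq> {} \<and> regular_on X U \<phi>"
  by (simp add: rational_reps_def)

lemma rep_const: "rep (points X) (\<lambda>_. c)"
  using points_nonempty regular_const[OF openin_topspace] by (simp add: rep_iff)

lemma rep_Int:
  assumes reg: "\<And>W \<phi> \<psi>. regular_on X W \<phi> \<Longrightarrow> regular_on X W \<psi> \<Longrightarrow>
      regular_on X W (\<lambda>x. b (\<phi> x) (\<psi> x))"
    and "rep U \<phi>" "rep V \<psi>"
  shows "rep (U \<inter> V) (\<lambda>x. b (\<phi> x) (\<psi> x))"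
proof -
  have "openin (zariski X) (U \<inter> V)" "U \<inter> V \<noteq> {}"
    using assms(2,3) opens_meet[of U V] by (auto simp: rep_iff)
  moreover have "regular_on X (U \<inter> V) \<phi>" "regular_on X (U \<inter> V) \<psi>"
    using regular_restrict[of U \<phi> "U \<inter> V"] regular_restrict[of V \<psi> "U \<inter> V"] assms(2,3) calculation(1)
    by (auto simp: rep_iff)
  ultimately show ?thesis using reg unfolding rep_iff by blast
qed

lemma rep_add: "rep U \<phi> \<Longrightarrow> rep V \<psi> \<Longrightarrow> rep (U \<inter> V) (\<lambda>x. \<phi> x + \<psi> x)"
  by (rule rep_Int[of "(+)"]) (rule regular_add)

lemma rep_mult: "rep U \<phi> \<Longrightarrow> rep V \<psi> \<Longrightarrow> rep (U \<inter> V) (\<lambda>x. \<phi> x * \<psi> x)"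
  by (rule rep_Int[of "(*)"]) (rule regular_mult)

lemma cls_self: "rep U \<phi> \<Longrightarrow> (U, \<phi>) \<in> cls U \<phi>"
  by (simp add: rational_class_def)

lemma cls_mem: "(V, \<psi>) \<in> cls U \<phi> \<longleftrightarrow> rep V \<psi> \<and> (\<forall>x\<in>U \<inter> V. \<phi> x = \<psi> x)"
  by (simp add: rational_class_def)

text \<open>
  Agreement of representatives on overlaps is transitive only because of the identity principle:
  \<open>\<psi>\<close> and \<open>\<xi>\<close> are known to agree merely on the part of \<open>V \<inter> W\<close> that lies in \<open>U\<close>.
\<close>

lemma agree_trans:
  assumes "rep U \<phi>" "rep V \<psi>" "rep W \<xi>"
    and "\<And>x. x \<in> U \<inter> V \<Longrightarrow> \<phi> x = \<psi> x" "\<And>x. x \<in> U \<inter> W \<Longrightarrow> \<phi> x = \<xi> x" "x \<in> V \<inter> W"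
  shows "\<psi> x = \<xi> x"
proof (rule regular_identity[of "V \<inter> W" _ _ "U \<inter> (V \<inter> W)"])
  have op: "openin (zariski X) U" "openin (zariski X) V" "openin (zariski X) W"
    "openin (zariski X) (V \<inter> W)" "openin (zariski X) (U \<inter> (V \<inter> W))"
    using assms(1-3) by (auto simp: rep_iff)
  then show "openin (zariski X) (V \<inter> W)" "openin (zariski X) (U \<inter> (V \<inter> W))" by auto
  show "regular_on X (V \<inter> W) \<psi>" "regular_on X (V \<inter> W) \<xi>"
    using assms(2,3) op regular_restrict[of V \<psi> "V \<inter> W"] regular_restrict[of W \<xi> "V \<inter> W"]
    by (auto simp: rep_iff)
  show "U \<inter> (V \<inter> W) \<noteq> {}"
    using opens_meet[OF op(1,4)] opens_meet[OF op(2,3)] assms(1-3) by (auto simp: rep_iff)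
  show "\<psi> y = \<xi> y" if "y \<in> U \<inter> (V \<inter> W)" for y
    using assms(4)[of y] assms(5)[of y] that by simp
qed (use assms(6) in auto)

lemma cls_eqI:
  assumes "rep U \<phi>" "rep V \<psi>" and agree: "\<And>x. x \<in> U \<Longrightarrow> x \<in> V \<Longrightarrow> \<phi> x = \<psi> x"
  shows "cls U \<phi> = cls V \<psi>"
proof -
  have "(W, \<xi>) \<in> cls U \<phi> \<longleftrightarrow> (W, \<xi>) \<in> cls V \<psi>" for W \<xi>
  proof
    assume "(W, \<xi>) \<in> cls U \<phi>"
    then show "(W, \<xi>) \<in> cls V \<psi>"
      unfolding cls_mem using agree_trans[OF assms(1,2), of W \<xi>] agree by blast
  next
    assume "(W, \<xi>) \<in> cls V \<psi>"
    then show "(W, \<xi>) \<in> cls U \<phi>"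
      unfolding cls_mem using agree_trans[OF assms(2,1), of W \<xi>] agree by (metis Int_iff)
  qed
  then show ?thesis by auto
qed

lemma cls_eqD:
  assumes "cls U \<phi> = cls V \<psi>" "rep V \<psi>" "x \<in> U" "x \<in> V"
  shows "\<phi> x = \<psi> x"
  using cls_self[OF assms(2)] assms unfolding assms(1)[symmetric] cls_mem by blast

text \<open>
  The ring operations are unions over all representatives; all terms of such a union coincide, so it
  can be evaluated at any one choice of representatives.
\<close>

lemma cls_Int:
  assumes reg: "\<And>W \<phi> \<psi>. regular_on X W \<phi> \<Longrightarrow> regular_on X W \<psi> \<Longrightarrow>
      regular_on X W (\<lambda>x. b (\<phi> x) (\<psi> x))"
    and "rep U \<phi>" "rep V \<psi>"
  shows "(\<Union>(U', \<phi>')\<in>cls U \<phi>. \<Union>(V', \<psi>')\<in>cls V \<psi>. cls (U' \<inter> V') (\<lambda>x. b (\<phi>' x) (\<psi>' x)))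
    = cls (U \<inter> V) (\<lambda>x. b (\<phi> x) (\<psi> x))"
proof -
  have "cls (U' \<inter> V') (\<lambda>x. b (\<phi>' x) (\<psi>' x)) = cls (U \<inter> V) (\<lambda>x. b (\<phi> x) (\<psi> x))"
    if "(U', \<phi>') \<in> cls U \<phi>" "(V', \<psi>') \<in> cls V \<psi>" for U' \<phi>' V' \<psi>'
  proof (rule cls_eqI)
    show "rep (U' \<inter> V') (\<lambda>x. b (\<phi>' x) (\<psi>' x))" "rep (U \<inter> V) (\<lambda>x. b (\<phi> x) (\<psi> x))"
      using that assms(2,3) by (auto simp: cls_mem intro!: rep_Int[OF reg])
  qed (use that in \<open>auto simp: cls_mem\<close>)
  then show ?thesis using cls_self[OF assms(2)] cls_self[OF assms(3)] by fast
qed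

lemma function_field_add:
  "rep U \<phi> \<Longrightarrow> rep V \<psi> \<Longrightarrow>
    cls U \<phi> \<oplus>\<^bsub>function_field X\<^esub> cls V \<psi> = cls (U \<inter> V) (\<lambda>x. \<phi> x + \<psi> x)"
  unfolding function_field_def ring.simps monoid.simps
  by (rule cls_Int[of "(+)"]) (rule regular_add)

lemma function_field_mult:
  "rep U \<phi> \<Longrightarrow> rep V \<psi> \<Longrightarrow>
    cls U \<phi> \<otimes>\<^bsub>function_field X\<^esub> cls V \<psi> = cls (U \<inter> V) (\<lambda>x. \<phi> x * \<psi> x)"
  unfolding function_field_def ring.simps monoid.simps
  by (rule cls_Int[of "(*)"]) (rule regular_mult)

lemma function_field_one: "\<one>\<^bsub>function_field X\<^esub> = cls (points X) (\<lambda>_. 1)"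
  and function_field_zero: "\<zero>\<^bsub>function_field X\<^esub> = cls (points X) (\<lambda>_. 0)"
  by (simp_all add: function_field_def)

lemma cls_in_function_field: "rep U \<phi> \<Longrightarrow> cls U \<phi> \<in> carrier (function_field X)"
  by (auto simp: function_field_def)

lemma function_field_cases:
  assumes "a \<in> carrier (function_field X)"
  obtains U \<phi> where "rep U \<phi>" "a = cls U \<phi>"
  using assms by (auto simp: function_field_def)

lemmas function_field_simps = function_field_add function_field_mult function_field_one
  function_field_zero rep_add rep_mult rep_const cls_in_function_field

lemma rep_restrict: "rep U \<phi> \<Longrightarrow> openin (zariski X) V \<Longrightarrow> V \<noteq> {} \<Longrightarrow> V \<subseteq> U \<Longrightarrow> rep V \<phi>"
  using regular_restrict by (auto simp: rep_iff)

lemma rep_Int_points: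
  assumes "rep U \<phi>"
  shows "rep (points X \<inter> U) \<phi>" "rep (U \<inter> points X) \<phi>"
  using assms openin_subset[of "zariski X" U] by (auto simp: rep_iff Int_absorb1 Int_absorb2)

lemma function_field_ring: "ring (function_field X)"
proof (intro ringI abelian_groupI monoidI)
  fix a assume "a \<in> carrier (function_field X)"
  then obtain U \<phi> where a: "rep U \<phi>" "a = cls U \<phi>" by (rule function_field_cases)
  have "rep (points X \<inter> U) (\<lambda>x. - 1 * \<phi> x)" using rep_mult[OF rep_const a(1)] .
  moreover have "cls (points X \<inter> U) (\<lambda>x. - 1 * \<phi> x) \<oplus>\<^bsub>function_field X\<^esub> a = \<zero>\<^bsub>function_field X\<^esub>"
    unfolding a(2) function_field_add[OF calculation a(1)] function_field_zero
    by (rule cls_eqI) (use rep_add[OF calculation a(1)] rep_const in auto)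
  ultimately show "\<exists>b\<in>carrier (function_field X). b \<oplus>\<^bsub>function_field X\<^esub> a = \<zero>\<^bsub>function_field X\<^esub>"
    using cls_in_function_field by blast
qed (auto elim!: function_field_cases simp: function_field_simps
    intro!: cls_eqI rep_add rep_mult rep_Int_points del: equalityI, simp_all add: algebra_simps)

text \<open>
  Dominance keeps the preimage of a nonempty open set nonempty, so pulling back representatives
  gives representatives.
\<close>

lemma
  assumes f: "morphism X Y f" "dominant X Y f" and rep: "(V, \<psi>) \<in> rational_reps Y"
  shows pullback_rep: "rep {x \<in> points X. f x \<in> V} (\<lambda>x. \<psi> (f x))"
    and pullback_class:
      "pullback X f (rational_class Y V \<psi>) = cls {x \<in> points X. f x \<in> V} (\<lambda>x. \<psi> (f x))"
proof -
  have *: "rep {x \<in> points X. f x \<in> V} (\<lambda>x. \<psi> (f x))" if "(V, \<psi>) \<in> rational_reps Y" for V \<psi>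
  proof -
    have V: "openin (zariski Y) V" "V \<noteq> {}" "regular_on Y V \<psi>"
      using that by (auto simp: rational_reps_def)
    have "V \<inter> f ` points X \<noteq> {}"
      using openin_Int_closure_of_eq_empty[OF V(1), of "f ` points X"] f(2) V(2) openin_subset[OF V(1)]
      by (auto simp: dominant_def)
    moreover have "openin (zariski X) {x \<in> points X. f x \<in> V}"
      using f(1) V(1) by (auto simp: morphism_def intro: openin_continuous_map_preimage)
    ultimately show ?thesis using f(1) V by (auto simp: rep_iff morphism_def)
  qed
  then show rep': "rep {x \<in> points X. f x \<in> V} (\<lambda>x. \<psi> (f x))" using rep .
  have "cls {x \<in> points X. f x \<in> V'} (\<lambda>x. \<psi>' (f x)) = cls {x \<in> points X. f x \<in> V} (\<lambda>x. \<psi> (f x))"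
    if "(V', \<psi>') \<in> rational_class Y V \<psi>" for V' \<psi>'
    using that by (intro cls_eqI * rep) (auto simp: rational_class_def)
  moreover have "(V, \<psi>) \<in> rational_class Y V \<psi>" using rep by (simp add: rational_class_def)
  ultimately show "pullback X f (rational_class Y V \<psi>) = cls {x \<in> points X. f x \<in> V} (\<lambda>x. \<psi> (f x))"
    unfolding pullback_def by fast
qed

end

section \<open>Rational functions on affine space\<close>

lemma affine_regular_const:
  assumes "openin affine_zariski U" shows "affine_regular U (\<lambda>_. c)"
  unfolding affine_regular_def
proof
  fix x assume "x \<in> U"
  then show "\<exists>V G H. openin affine_zariski V \<and> x \<in> V \<and> V \<subseteq> U \<and> poly_fun G \<and> poly_fun H \<and>
      (\<forall>y\<in>V. H y \<noteq> 0 \<and> c = G y / H y)"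
    using assms poly_fun.const[of c] poly_fun.const[of 1]
    by (intro exI[of _ U] exI[of _ "\<lambda>_. c"] exI[of _ "\<lambda>_. 1"]) auto
qed

lemma affine_regular_cases:
  assumes "affine_regular U \<phi>" "x \<in> U"
  obtains V G H where "openin affine_zariski V" "x \<in> V" "V \<subseteq> U" "poly_fun G" "poly_fun H"
    "\<And>y. y \<in> V \<Longrightarrow> H y \<noteq> 0" "\<And>y. y \<in> V \<Longrightarrow> \<phi> y = G y / H y"
  using bspec[OF assms(1)[unfolded affine_regular_def] assms(2)] by (elim exE conjE) simp

lemma affine_regularI:
  assumes "\<And>x. x \<in> U \<Longrightarrow> \<exists>V G H. openin affine_zariski V \<and> x \<in> V \<and> V \<subseteq> U \<and> poly_fun G \<and>
      poly_fun H \<and> (\<forall>y\<in>V. H y \<noteq> 0 \<and> \<phi> y = G y / H y)"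
  shows "affine_regular U \<phi>"
  unfolding affine_regular_def using assms by (rule ballI)

lemma affine_regular_add:
  assumes "affine_regular U \<phi>" "affine_regular U \<psi>"
  shows "affine_regular U (\<lambda>x. \<phi> x + \<psi> x)"
proof (rule affine_regularI)
  fix x assume x: "x \<in> U"
  from affine_regular_cases[OF assms(1) x] obtain V G H where
    V: "openin affine_zariski V" "x \<in> V" "V \<subseteq> U" "poly_fun G" "poly_fun H"
      "\<And>y. y \<in> V \<Longrightarrow> H y \<noteq> 0" "\<And>y. y \<in> V \<Longrightarrow> \<phi> y = G y / H y" by metis
  from affine_regular_cases[OF assms(2) x] obtain V' G' H' where
    V': "openin affine_zariski V'" "x \<in> V'" "V' \<subseteq> U" "poly_fun G'" "poly_fun H'"
      "\<And>y. y \<in> V' \<Longrightarrow> H' y \<noteq> 0" "\<And>y. y \<in> V' \<Longrightarrow> \<psi> y = G' y / H' y" by metis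
  have "\<phi> y + \<psi> y = (G y * H' y + G' y * H y) / (H y * H' y)" if "y \<in> V \<inter> V'" for y
    using V(6,7)[of y] V'(6,7)[of y] that by (simp add: field_simps)
  then show "\<exists>V G H. openin affine_zariski V \<and> x \<in> V \<and> V \<subseteq> U \<and> poly_fun G \<and> poly_fun H \<and>
      (\<forall>y\<in>V. H y \<noteq> 0 \<and> \<phi> y + \<psi> y = G y / H y)"
    using V(1-6) V'(1-6)
    by (intro exI[of _ "V \<inter> V'"] exI[of _ "\<lambda>y. G y * H' y + G' y * H y"] exI[of _ "\<lambda>y. H y * H' y"])
       (auto intro: poly_fun.add poly_fun.mult)
qed

lemma affine_regular_mult:
  assumes "affine_regular U \<phi>" "affine_regular U \<psi>"
  shows "affine_regular U (\<lambda>x. \<phi> x * \<psi> x)"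
proof (rule affine_regularI)
  fix x assume x: "x \<in> U"
  from affine_regular_cases[OF assms(1) x] obtain V G H where
    V: "openin affine_zariski V" "x \<in> V" "V \<subseteq> U" "poly_fun G" "poly_fun H"
      "\<And>y. y \<in> V \<Longrightarrow> H y \<noteq> 0" "\<And>y. y \<in> V \<Longrightarrow> \<phi> y = G y / H y" by metis
  from affine_regular_cases[OF assms(2) x] obtain V' G' H' where
    V': "openin affine_zariski V'" "x \<in> V'" "V' \<subseteq> U" "poly_fun G'" "poly_fun H'"
      "\<And>y. y \<in> V' \<Longrightarrow> H' y \<noteq> 0" "\<And>y. y \<in> V' \<Longrightarrow> \<psi> y = G' y / H' y" by metis
  have "\<phi> y * \<psi> y = (G y * G' y) / (H y * H' y)" if "y \<in> V \<inter> V'" for y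
    using V(7)[of y] V'(7)[of y] that by simp
  then show "\<exists>V G H. openin affine_zariski V \<and> x \<in> V \<and> V \<subseteq> U \<and> poly_fun G \<and> poly_fun H \<and>
      (\<forall>y\<in>V. H y \<noteq> 0 \<and> \<phi> y * \<psi> y = G y / H y)"
    using V(1-6) V'(1-6)
    by (intro exI[of _ "V \<inter> V'"] exI[of _ "\<lambda>y. G y * G' y"] exI[of _ "\<lambda>y. H y * H' y"])
       (auto intro: poly_fun.mult)
qed

lemma affine_regular_restrict:
  assumes "affine_regular U \<phi>" "openin affine_zariski W" "W \<subseteq> U"
  shows "affine_regular W \<phi>"
proof (rule affine_regularI)
  fix x assume x: "x \<in> W"
  then have "x \<in> U" using assms(3) by blast
  from affine_regular_cases[OF assms(1) this] obtain V G H where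
    V: "openin affine_zariski V" "x \<in> V" "V \<subseteq> U" "poly_fun G" "poly_fun H"
      "\<And>y. y \<in> V \<Longrightarrow> H y \<noteq> 0" "\<And>y. y \<in> V \<Longrightarrow> \<phi> y = G y / H y" by metis
  then show "\<exists>V G H. openin affine_zariski V \<and> x \<in> V \<and> V \<subseteq> W \<and> poly_fun G \<and> poly_fun H \<and>
      (\<forall>y\<in>V. H y \<noteq> 0 \<and> \<phi> y = G y / H y)"
    using x assms(2) by (intro exI[of _ "V \<inter> W"] exI[of _ G] exI[of _ H]) auto
qed

text \<open>
  Near \<open>x\<close> both functions are fractions, and the cross difference of these fractions is a polynomial
  that vanishes on a nonempty open set.
\<close>

lemma affine_regular_identity:
  assumes "affine_regular U \<phi>" "affine_regular U \<psi>"
    and W: "openin affine_zariski W" "W \<noteq> {}" "\<And>y. y \<in> W \<Longrightarrow> \<phi> y = \<psi> y" and x: "x \<in> U"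
  shows "\<phi> x = \<psi> x"
proof -
  from affine_regular_cases[OF assms(1) x] obtain V G H where
    V: "openin affine_zariski V" "x \<in> V" "V \<subseteq> U" "poly_fun G" "poly_fun H"
      "\<And>y. y \<in> V \<Longrightarrow> H y \<noteq> 0" "\<And>y. y \<in> V \<Longrightarrow> \<phi> y = G y / H y" by metis
  from affine_regular_cases[OF assms(2) x] obtain V' G' H' where
    V': "openin affine_zariski V'" "x \<in> V'" "V' \<subseteq> U" "poly_fun G'" "poly_fun H'"
      "\<And>y. y \<in> V' \<Longrightarrow> H' y \<noteq> 0" "\<And>y. y \<in> V' \<Longrightarrow> \<psi> y = G' y / H' y" by metis
  have VV: "openin affine_zariski (V \<inter> V')" "V \<inter> V' \<noteq> {}" using V(1,2) V'(1,2) by auto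
  have "G x * H' x - G' x * H x = 0"
  proof (rule poly_fun_zero_of_open)
    show "poly_fun (\<lambda>x. G x * H' x - G' x * H x)"
      using V(4,5) V'(4,5) by (intro poly_fun_diff poly_fun.mult)
    show "openin affine_zariski (W \<inter> (V \<inter> V'))" using W(1) VV(1) by auto
    show "W \<inter> (V \<inter> V') \<noteq> {}" using affine_opens_meet[OF W(1) VV(1) W(2) VV(2)] .
    fix y assume "y \<in> W \<inter> (V \<inter> V')"
    then show "G y * H' y - G' y * H y = 0"
      using W(3)[of y] V(6,7)[of y] V'(6,7)[of y] by (auto simp: field_simps)
  qed
  then have "G x / H x = G' x / H' x"
    using V(6)[OF V(2)] V'(6)[OF V'(2)] by (simp add: frac_eq_eq)
  then show ?thesis using V(7)[OF V(2)] V'(7)[OF V'(2)] by simp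
qed

lemma affine_space_simps [simp]:
  "zariski affine_space = affine_zariski" "regular_on affine_space = affine_regular"
  by (simp_all add: affine_space_def)

interpretation affine: integral_variety "affine_space :: (complex ^ 'n) variety"
proof
  show "points (affine_space :: (complex ^ 'n) variety) \<noteq> {}"
    by simp
qed (auto simp: affine_regular_const affine_regular_add affine_regular_mult
      intro: affine_regular_restrict affine_regular_identity dest: affine_opens_meet)

lemma affine_rep_fraction:
  assumes "poly_fun G" "poly_fun H" "H a \<noteq> 0"
  shows "affine.rep {z. H z \<noteq> 0} (\<lambda>z. G z / H z)"
proof -
  have "affine_regular {z. H z \<noteq> 0} (\<lambda>z. G z / H z)"
    using assms openin_nonzero_locus[OF assms(2)]
    by (intro affine_regularI exI[of _ "{z. H z \<noteq> 0}"] exI[of _ G] exI[of _ H]) auto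
  then show ?thesis
    using openin_nonzero_locus[OF assms(2)] assms(3) unfolding affine.rep_iff by auto
qed

lemma affine_rep_poly: "poly_fun G \<Longrightarrow> affine.rep UNIV G"
  using affine_rep_fraction[OF _ poly_fun.const[of 1]] by simp

text \<open>
  A rational function is determined by its restriction to a neighbourhood on which it is a single
  fraction.
\<close>

lemma affine_class_fraction:
  assumes "a \<in> carrier (function_field affine_space)"
  obtains G H c where "poly_fun G" "poly_fun H" "H c \<noteq> 0"
    "a = affine.cls {z. H z \<noteq> 0} (\<lambda>z. G z / H z)"
proof -
  obtain U \<phi> where U: "affine.rep U \<phi>" "a = affine.cls U \<phi>"
    using assms by (rule affine.function_field_cases)
  then have reg: "affine_regular U \<phi>" and "U \<noteq> {}"
    by (auto simp: affine.rep_iff)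
  then obtain x where x: "x \<in> U" by blast
  from affine_regular_cases[OF reg x] obtain V G H where
    V: "openin affine_zariski V" "x \<in> V" "V \<subseteq> U" "poly_fun G" "poly_fun H"
      "\<And>y. y \<in> V \<Longrightarrow> H y \<noteq> 0" "\<And>y. y \<in> V \<Longrightarrow> \<phi> y = G y / H y" by metis
  have H: "H x \<noteq> 0" using V(2,6) by blast
  have repV: "affine.rep V \<phi>"
    using affine.rep_restrict[OF U(1), of V] V(1-3) by auto
  have "a = affine.cls V \<phi>"
    unfolding U(2) by (rule affine.cls_eqI[OF U(1) repV]) simp
  also have "\<dots> = affine.cls {z. H z \<noteq> 0} (\<lambda>z. G z / H z)"
    by (rule affine.cls_eqI[OF repV affine_rep_fraction[OF V(4,5) H]]) (simp add: V(7))
  finally show ?thesis using that[OF V(4,5) H] by blast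
qed

section \<open>Laurent polynomials and the inversions of the torus\<close>

definition torus :: "(complex ^ 2) set" where
  "torus = {z. z $ 1 \<noteq> 0 \<and> z $ 2 \<noteq> 0}"

lemma torus_nth: "z \<in> torus \<Longrightarrow> z $ i \<noteq> 0"
  using exhaust_2[of i] by (auto simp: torus_def)

definition invert :: "2 \<Rightarrow> complex ^ 2 \<Rightarrow> complex ^ 2" where
  "invert i z = (\<chi> k. if k = i then 1 / z $ k else z $ k)"

lemma invert_nth: "invert i z $ k = (if k = i then 1 / z $ k else z $ k)"
  by (simp add: invert_def)

lemma invert_torus: "z \<in> torus \<Longrightarrow> invert i z \<in> torus"
  by (simp add: torus_def invert_nth)

lemma invert_invert [simp]: "invert i (invert i z) = z"
  by (simp add: vec_eq_iff invert_nth)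

text \<open>
  The coordinates \<open>u = x + 1 / x\<close> and \<open>v = y + 1 / y\<close>, which generate the functions invariant under both
  inversions.
\<close>

definition invariants :: "complex ^ 2 \<Rightarrow> complex ^ 2" where
  "invariants z = (\<chi> k. z $ k + 1 / z $ k)"

lemma invariants_nth [simp]: "invariants z $ k = z $ k + 1 / z $ k"
  by (simp add: invariants_def)

lemma invariants_invert: "invariants (invert i z) = invariants z"
  by (simp add: vec_eq_iff invert_nth)

text \<open>
  Closure under the operations that build polynomials. Functions are total, but only their values on
  the torus are meant to matter; the predicates below are therefore stated up to equality there.
\<close>

definition function_algebra :: "((complex ^ 2 \<Rightarrow> complex) \<Rightarrow> bool) \<Rightarrow> bool" where
  "function_algebra T \<longleftrightarrow> (\<forall>c. T (\<lambda>_. c)) \<and>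
     (\<forall>F G. T F \<longrightarrow> T G \<longrightarrow> T (\<lambda>z. F z + G z) \<and> T (\<lambda>z. F z * G z))"

lemma function_algebraD:
  assumes "function_algebra T"
  shows "T (\<lambda>_. c)" "T F \<Longrightarrow> T G \<Longrightarrow> T (\<lambda>z. F z + G z)" "T F \<Longrightarrow> T G \<Longrightarrow> T (\<lambda>z. F z * G z)"
  using assms by (simp_all add: function_algebra_def)

lemma poly_fun_in_algebra:
  assumes "poly_fun p" "function_algebra T" "\<And>k. T (\<lambda>z. g z $ k)"
  shows "T (\<lambda>z. p (g z))"
  using assms(1) by induction (auto intro: function_algebraD[OF assms(2)] assms(3))

definition laurent :: "(complex ^ 2 \<Rightarrow> complex) \<Rightarrow> bool" where
  "laurent F \<longleftrightarrow> (\<exists>P n. poly_fun P \<and> (\<forall>z\<in>torus. (z $ 1 * z $ 2) ^ n * F z = P z))"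

lemma laurentI: "poly_fun P \<Longrightarrow> (\<And>z. z \<in> torus \<Longrightarrow> (z $ 1 * z $ 2) ^ n * F z = P z) \<Longrightarrow> laurent F"
  unfolding laurent_def by blast

lemma function_algebra_laurent: "function_algebra laurent"
  unfolding function_algebra_def
proof (intro conjI allI impI)
  show "laurent (\<lambda>_. c)" for c by (rule laurentI[OF poly_fun.const[of c], of 0]) simp
  fix F G assume "laurent F" "laurent G"
  then obtain P n Q m where P: "poly_fun P" "\<And>z. z \<in> torus \<Longrightarrow> (z $ 1 * z $ 2) ^ n * F z = P z"
    and Q: "poly_fun Q" "\<And>z. z \<in> torus \<Longrightarrow> (z $ 1 * z $ 2) ^ m * G z = Q z"
    unfolding laurent_def by metis
  show "laurent (\<lambda>z. F z + G z)"
  proof (rule laurentI[of _ "n + m"])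
    show "poly_fun (\<lambda>z. (z $ 1 * z $ 2) ^ m * P z + (z $ 1 * z $ 2) ^ n * Q z)"
      by (intro poly_fun.add poly_fun.mult poly_fun_power poly_fun.coord P(1) Q(1))
    fix z :: "complex ^ 2" assume "z \<in> torus"
    from P(2)[OF this, symmetric] Q(2)[OF this, symmetric]
    show "(z $ 1 * z $ 2) ^ (n + m) * (F z + G z) = (z $ 1 * z $ 2) ^ m * P z + (z $ 1 * z $ 2) ^ n * Q z"
      by (simp only: power_add) (simp add: algebra_simps)
  qed
  show "laurent (\<lambda>z. F z * G z)"
  proof (rule laurentI[of _ "n + m"])
    show "poly_fun (\<lambda>z. P z * Q z)" by (intro poly_fun.mult P(1) Q(1))
    fix z :: "complex ^ 2" assume "z \<in> torus"
    from P(2)[OF this, symmetric] Q(2)[OF this, symmetric]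
    show "(z $ 1 * z $ 2) ^ (n + m) * (F z * G z) = P z * Q z"
      by (simp only: power_add) (simp add: algebra_simps)
  qed
qed

lemma laurent_coord: "laurent (\<lambda>z. z $ k)"
  by (rule laurentI[OF poly_fun.coord, of 0]) simp

lemma laurent_inverse_coord: "laurent (\<lambda>z. 1 / z $ k)"
proof -
  consider "k = 1" | "k = 2" using exhaust_2 by blast
  then show ?thesis
  proof cases
    case 1
    show ?thesis
      by (rule laurentI[OF poly_fun.coord[of 2], of 1]) (auto simp: 1 torus_def)
  next
    case 2
    show ?thesis
      by (rule laurentI[OF poly_fun.coord[of 1], of 1]) (auto simp: 2 torus_def)
  qed
qed

lemma torus_open: "openin affine_zariski torus" and torus_nonempty: "torus \<noteq> {}"
proof -
  have "torus = {z :: complex ^ 2. z $ 1 * z $ 2 \<noteq> 0}" by (auto simp: torus_def)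
  moreover have "poly_fun (\<lambda>z :: complex ^ 2. z $ 1 * z $ 2)"
    by (intro poly_fun.mult poly_fun.coord)
  ultimately show "openin affine_zariski torus" using openin_nonzero_locus by metis
  have "(\<chi> k. 1) \<in> torus" by (simp add: torus_def)
  then show "torus \<noteq> {}" by blast
qed

text \<open>
  Up to a monomial, which is nonzero on the torus, both functions are polynomials, and nonempty
  Zariski open sets meet.
\<close>

lemma laurent_product_nonzero:
  assumes "laurent F" "laurent G" "z \<in> torus" "F z \<noteq> 0" "w \<in> torus" "G w \<noteq> 0"
  shows "\<exists>y\<in>torus. F y * G y \<noteq> 0"
proof -
  have open_locus: "openin affine_zariski {y\<in>torus. F y \<noteq> 0}" if F: "laurent F" for F
  proof -
    obtain P n where P: "poly_fun P" "\<And>z. z \<in> torus \<Longrightarrow> (z $ 1 * z $ 2) ^ n * F z = P z"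
      using F unfolding laurent_def by metis
    have "P z \<noteq> 0 \<longleftrightarrow> F z \<noteq> 0" if "z \<in> torus" for z
      using P(2)[OF that, symmetric] that by (auto simp: torus_def)
    then have "{y\<in>torus. F y \<noteq> 0} = torus \<inter> {y. P y \<noteq> 0}" by auto
    then show ?thesis using torus_open openin_nonzero_locus[OF P(1)] by auto
  qed
  have "{y\<in>torus. F y \<noteq> 0} \<inter> {y\<in>torus. G y \<noteq> 0} \<noteq> {}"
    using assms by (intro affine_opens_meet open_locus) auto
  then show ?thesis by auto
qed

text \<open>
  The module \<open>T + T z\<^sub>i\<close>. When \<open>T\<close> contains the trace \<open>z\<^sub>i + 1 / z\<^sub>i\<close>, it is the quadratic ring extension of
  \<open>T\<close> generated by \<open>z\<^sub>i\<close>, whose other conjugate is \<open>1 / z\<^sub>i\<close>.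
\<close>

definition quad_ext :: "2 \<Rightarrow> ((complex ^ 2 \<Rightarrow> complex) \<Rightarrow> bool) \<Rightarrow> (complex ^ 2 \<Rightarrow> complex) \<Rightarrow> bool" where
  "quad_ext i T F \<longleftrightarrow> (\<exists>A B. T A \<and> T B \<and> (\<forall>z\<in>torus. F z = A z + B z * z $ i))"

lemma quad_extI: "T A \<Longrightarrow> T B \<Longrightarrow> (\<And>z. z \<in> torus \<Longrightarrow> F z = A z + B z * z $ i) \<Longrightarrow> quad_ext i T F"
  unfolding quad_ext_def by blast

lemma quad_ext_base: "function_algebra T \<Longrightarrow> T F \<Longrightarrow> quad_ext i T F"
  by (rule quad_extI[of _ F "\<lambda>_. 0"]) (auto intro: function_algebraD)

lemma quad_ext_generator: "function_algebra T \<Longrightarrow> quad_ext i T (\<lambda>z. z $ i)"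
  by (rule quad_extI[of _ "\<lambda>_. 0" "\<lambda>_. 1"]) (auto intro: function_algebraD)

text \<open>
  Products are reduced with \<open>z\<^sub>i\<^sup>2 = (z\<^sub>i + 1 / z\<^sub>i) z\<^sub>i - 1\<close>.
\<close>

lemma function_algebra_quad_ext:
  assumes T: "function_algebra T" and trace: "T (\<lambda>z. z $ i + 1 / z $ i)"
  shows "function_algebra (quad_ext i T)"
  unfolding function_algebra_def
proof (intro conjI allI impI)
  show "quad_ext i T (\<lambda>_. c)" for c
    by (rule quad_ext_base[OF T]) (rule function_algebraD(1)[OF T])
  fix F G assume "quad_ext i T F" "quad_ext i T G"
  then obtain A B C D where
    AB: "T A" "T B" "\<And>z. z \<in> torus \<Longrightarrow> F z = A z + B z * z $ i" and
    CD: "T C" "T D" "\<And>z. z \<in> torus \<Longrightarrow> G z = C z + D z * z $ i"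
    unfolding quad_ext_def by metis
  note T_intros = function_algebraD[OF T] AB(1,2) CD(1,2) trace
  show "quad_ext i T (\<lambda>z. F z + G z)"
    by (rule quad_extI[of _ "\<lambda>z. A z + C z" "\<lambda>z. B z + D z"])
       (auto simp: AB(3) CD(3) algebra_simps intro: T_intros)
  show "quad_ext i T (\<lambda>z. F z * G z)"
  proof (rule quad_extI[of _ "\<lambda>z. A z * C z + (-1) * (B z * D z)"
        "\<lambda>z. (A z * D z + B z * C z) + B z * D z * (z $ i + 1 / z $ i)"])
    show "T (\<lambda>z. A z * C z + (-1) * (B z * D z))" by (intro T_intros)
    show "T (\<lambda>z. (A z * D z + B z * C z) + B z * D z * (z $ i + 1 / z $ i))" by (intro T_intros)
    fix z :: "complex ^ 2" assume "z \<in> torus"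
    then show "F z * G z = A z * C z + (-1) * (B z * D z) +
        ((A z * D z + B z * C z) + B z * D z * (z $ i + 1 / z $ i)) * z $ i"
      using torus_nth[of z i] by (simp add: AB(3) CD(3) field_simps)
  qed
qed

text \<open>
  With \<open>s = z\<^sub>i + 1 / z\<^sub>i\<close>, the conjugate of \<open>A + B z\<^sub>i\<close> is \<open>A + B / z\<^sub>i = (A + B s) - B z\<^sub>i\<close>, and the
  norm, the product of the two, is \<open>A\<^sup>2 + A B s + B\<^sup>2\<close>. The last clause writes the norm as a product of
  values of \<open>F\<close>, which is how it is seen not to vanish identically.
\<close>

lemma quad_ext_norm:
  assumes T: "function_algebra T" and trace: "T (\<lambda>z. z $ i + 1 / z $ i)"
    and inv: "\<And>A z. T A \<Longrightarrow> z \<in> torus \<Longrightarrow> A (invert i z) = A z"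
    and F: "quad_ext i T F"
  shows "\<exists>C N. quad_ext i T C \<and> T N \<and>
    (\<forall>z\<in>torus. F z * C z = N z \<and> N z = F z * F (invert i z))"
proof -
  obtain A B where AB: "T A" "T B" "\<And>z. z \<in> torus \<Longrightarrow> F z = A z + B z * z $ i"
    using F unfolding quad_ext_def by metis
  note T_intros = function_algebraD[OF T] AB(1,2) trace
  let ?s = "\<lambda>z :: complex ^ 2. z $ i + 1 / z $ i"
  let ?C = "\<lambda>z. (A z + B z * ?s z) + (-1) * B z * z $ i"
  let ?N = "\<lambda>z. A z * A z + A z * B z * ?s z + B z * B z"
  have "quad_ext i T ?C"
  proof (rule quad_extI)
    show "T (\<lambda>z. A z + B z * ?s z)" "T (\<lambda>z. (-1) * B z)" by (intro T_intros)+
  qed simp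
  moreover have "T ?N" by (intro T_intros)
  moreover have "F z * ?C z = ?N z \<and> ?N z = F z * F (invert i z)" if z: "z \<in> torus" for z
  proof -
    have "F (invert i z) = A z + B z * (1 / z $ i)"
      using AB(3)[OF invert_torus[OF z]] inv[OF AB(1) z] inv[OF AB(2) z] by (simp add: invert_nth)
    then show ?thesis
      using torus_nth[OF z, of i] by (simp add: AB(3)[OF z] field_simps)
  qed
  ultimately show ?thesis by blast
qed

definition inversion_symmetric :: "(complex ^ 2 \<Rightarrow> complex) \<Rightarrow> bool" where
  "inversion_symmetric F \<longleftrightarrow> (\<exists>p. poly_fun p \<and> (\<forall>z\<in>torus. F z = p (invariants z)))"

lemma inversion_symmetricI: "poly_fun p \<Longrightarrow> (\<And>z. z \<in> torus \<Longrightarrow> F z = p (invariants z)) \<Longrightarrow> inversion_symmetric F"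
  unfolding inversion_symmetric_def by blast

lemma function_algebra_inversion_symmetric: "function_algebra inversion_symmetric"
  unfolding function_algebra_def
proof (intro conjI allI impI)
  show "inversion_symmetric (\<lambda>_. c)" for c by (rule inversion_symmetricI[OF poly_fun.const[of c]]) simp
  fix F G assume "inversion_symmetric F" "inversion_symmetric G"
  then obtain p q where p: "poly_fun p" "\<And>z. z \<in> torus \<Longrightarrow> F z = p (invariants z)"
    and q: "poly_fun q" "\<And>z. z \<in> torus \<Longrightarrow> G z = q (invariants z)"
    unfolding inversion_symmetric_def by metis
  show "inversion_symmetric (\<lambda>z. F z + G z)"
    by (rule inversion_symmetricI[OF poly_fun.add[OF p(1) q(1)]]) (simp add: p(2) q(2))
  show "inversion_symmetric (\<lambda>z. F z * G z)"
    by (rule inversion_symmetricI[OF poly_fun.mult[OF p(1) q(1)]]) (simp add: p(2) q(2))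
qed

lemma inversion_symmetric_trace: "inversion_symmetric (\<lambda>z. z $ i + 1 / z $ i)"
  by (rule inversion_symmetricI[OF poly_fun.coord[of i]]) simp

lemma inversion_symmetric_invert: "inversion_symmetric F \<Longrightarrow> z \<in> torus \<Longrightarrow> F (invert i z) = F z"
  unfolding inversion_symmetric_def using invert_torus invariants_invert by metis

text \<open>
  The denominator \<open>H\<close> lies in the tower of two quadratic extensions over the polynomials in \<open>u, v\<close>.
  Two successive norms give a multiple \<open>q(u, v)\<close> of \<open>H\<close>, so that \<open>G / H\<close> becomes a fraction with
  denominator \<open>q(u, v)\<close> and a numerator in the tower. As a product of the four functions obtained from
  \<open>H\<close> by inverting coordinates, each a nonzero Laurent polynomial, \<open>q(u, v)\<close> is not identically zero.
\<close>

lemma fraction_in_basis: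
  assumes "poly_fun G" "poly_fun H" "H a \<noteq> 0"
  shows "\<exists>p0 p1 p2 p3 q. poly_fun p0 \<and> poly_fun p1 \<and> poly_fun p2 \<and> poly_fun p3 \<and> poly_fun q \<and>
    (\<exists>z\<in>torus. q (invariants z) \<noteq> 0) \<and>
    (\<forall>z\<in>torus. H z \<noteq> 0 \<longrightarrow> q (invariants z) \<noteq> 0 \<longrightarrow>
      G z / H z = p0 (invariants z) / q (invariants z) + p1 (invariants z) / q (invariants z) * z $ 1 +
        p2 (invariants z) / q (invariants z) * z $ 2 +
        p3 (invariants z) / q (invariants z) * (z $ 1 * z $ 2))"
proof -
  let ?S1 = "quad_ext 1 inversion_symmetric" let ?S2 = "quad_ext 2 ?S1"
  note alg0 = function_algebra_inversion_symmetric
  have alg1: "function_algebra ?S1" by (rule function_algebra_quad_ext[OF alg0 inversion_symmetric_trace])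
  have trace1: "?S1 (\<lambda>z. z $ 2 + 1 / z $ 2)" by (rule quad_ext_base[OF alg0 inversion_symmetric_trace])
  have alg2: "function_algebra ?S2" by (rule function_algebra_quad_ext[OF alg1 trace1])
  have inv1: "A (invert 2 z) = A z" if A: "?S1 A" and z: "z \<in> torus" for A z
  proof -
    obtain C D where CD: "inversion_symmetric C" "inversion_symmetric D" "\<And>z. z \<in> torus \<Longrightarrow> A z = C z + D z * z $ 1"
      using A unfolding quad_ext_def by metis
    show ?thesis
      using inversion_symmetric_invert[OF CD(1) z, of 2] inversion_symmetric_invert[OF CD(2) z, of 2]
      by (simp add: CD(3) z invert_torus invert_nth)
  qed
  have coord2: "?S2 (\<lambda>z. z $ k)" for k
  proof -
    consider "k = 1" | "k = 2" using exhaust_2 by blast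
    then show ?thesis
      using quad_ext_base[OF alg1 quad_ext_generator[OF alg0, of 1]] quad_ext_generator[OF alg1, of 2]
      by cases auto
  qed
  have poly2: "?S2 P" if "poly_fun P" for P
    using poly_fun_in_algebra[OF that alg2, of "\<lambda>z. z"] coord2 by simp
  obtain C1 N1 where C1: "?S2 C1" "?S1 N1"
    "\<And>z. z \<in> torus \<Longrightarrow> H z * C1 z = N1 z" "\<And>z. z \<in> torus \<Longrightarrow> N1 z = H z * H (invert 2 z)"
    using quad_ext_norm[OF alg1 trace1 inv1 poly2[OF assms(2)]] by blast
  obtain C0 N0 where C0: "?S1 C0" "inversion_symmetric N0"
    "\<And>z. z \<in> torus \<Longrightarrow> N1 z * C0 z = N0 z" "\<And>z. z \<in> torus \<Longrightarrow> N0 z = N1 z * N1 (invert 1 z)"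
    using quad_ext_norm[OF alg0 inversion_symmetric_trace inversion_symmetric_invert C1(2)] by blast
  obtain q where q: "poly_fun q" "\<And>z. z \<in> torus \<Longrightarrow> N0 z = q (invariants z)"
    using C0(2) unfolding inversion_symmetric_def by metis
  have "?S2 (\<lambda>z. G z * (C1 z * C0 z))"
    by (intro function_algebraD(3)[OF alg2] poly2 assms(1) C1(1) quad_ext_base[OF alg1 C0(1)])
  then obtain A B where AB: "?S1 A" "?S1 B"
    "\<And>z. z \<in> torus \<Longrightarrow> G z * (C1 z * C0 z) = A z + B z * z $ 2"
    unfolding quad_ext_def[of 2] by metis
  obtain A0 A1 where A: "inversion_symmetric A0" "inversion_symmetric A1" "\<And>z. z \<in> torus \<Longrightarrow> A z = A0 z + A1 z * z $ 1"
    using AB(1) unfolding quad_ext_def by metis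
  obtain B0 B1 where B: "inversion_symmetric B0" "inversion_symmetric B1" "\<And>z. z \<in> torus \<Longrightarrow> B z = B0 z + B1 z * z $ 1"
    using AB(2) unfolding quad_ext_def by metis
  obtain p0 where p0: "poly_fun p0" "\<And>z. z \<in> torus \<Longrightarrow> A0 z = p0 (invariants z)"
    using A(1) unfolding inversion_symmetric_def by metis
  obtain p1 where p1: "poly_fun p1" "\<And>z. z \<in> torus \<Longrightarrow> A1 z = p1 (invariants z)"
    using A(2) unfolding inversion_symmetric_def by metis
  obtain p2 where p2: "poly_fun p2" "\<And>z. z \<in> torus \<Longrightarrow> B0 z = p2 (invariants z)"
    using B(1) unfolding inversion_symmetric_def by metis
  obtain p3 where p3: "poly_fun p3" "\<And>z. z \<in> torus \<Longrightarrow> B1 z = p3 (invariants z)"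
    using B(2) unfolding inversion_symmetric_def by metis
  have nonzero: "\<exists>z\<in>torus. q (invariants z) \<noteq> 0"
  proof -
    \<comment> \<open>The four conjugates are multiplied in two steps, matching the two norms.\<close>
    have H: "laurent (\<lambda>z. H (g z))" if "\<And>k. laurent (\<lambda>z. g z $ k)" for g
      using poly_fun_in_algebra[OF assms(2) function_algebra_laurent] that by blast
    have inv_l: "laurent (\<lambda>z. invert i z $ k)" for i k
      by (cases "k = i") (simp_all add: invert_nth laurent_coord laurent_inverse_coord)
    have inv_ll: "laurent (\<lambda>z. invert 2 (invert 1 z) $ k)" for k
    proof -
      consider "k = 1" | "k = 2" using exhaust_2 by blast
      then show ?thesis by cases (simp_all add: invert_nth laurent_inverse_coord)
    qed
    have "{z. H z \<noteq> 0} \<inter> torus \<noteq> {}"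
      using assms(3) by (intro affine_opens_meet openin_nonzero_locus assms(2) torus_open torus_nonempty) auto
    then obtain z where z: "z \<in> torus" "H z \<noteq> 0" by blast
    have L1: "laurent (\<lambda>z. H z * H (invert 2 z))"
      by (intro function_algebraD(3)[OF function_algebra_laurent] H laurent_coord inv_l)
    have L2: "laurent (\<lambda>z. H (invert 1 z) * H (invert 2 (invert 1 z)))"
      by (intro function_algebraD(3)[OF function_algebra_laurent] H inv_l inv_ll)
    obtain y where y: "y \<in> torus" "H y * H (invert 2 y) \<noteq> 0"
      using laurent_product_nonzero[OF H[OF laurent_coord] H[OF inv_l], of z "invert 2 z" 2] z
        invert_torus by auto
    obtain x where "x \<in> torus"
      "(H x * H (invert 2 x)) * (H (invert 1 x) * H (invert 2 (invert 1 x))) \<noteq> 0"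
      using laurent_product_nonzero[OF L1 L2, of y "invert 1 y"] y invert_torus by auto
    then show ?thesis
      using q(2) C0(4) C1(4) invert_torus by (intro bexI[of _ x]) (metis, assumption)
  qed
  have "G z / H z = p0 (invariants z) / q (invariants z) + p1 (invariants z) / q (invariants z) * z $ 1 +
      p2 (invariants z) / q (invariants z) * z $ 2 +
      p3 (invariants z) / q (invariants z) * (z $ 1 * z $ 2)"
    if z: "z \<in> torus" and nz: "H z \<noteq> 0" "q (invariants z) \<noteq> 0" for z
  proof -
    have qz: "q (invariants z) = H z * (C1 z * C0 z)"
      using q(2)[OF z] C0(3)[OF z] C1(3)[OF z] by (metis mult.assoc)
    then have "G z / H z = (G z * (C1 z * C0 z)) / q (invariants z)" using nz by auto
    also have "G z * (C1 z * C0 z) = p0 (invariants z) + p1 (invariants z) * z $ 1 +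
        p2 (invariants z) * z $ 2 + p3 (invariants z) * (z $ 1 * z $ 2)"
      using AB(3)[OF z] A(3)[OF z] B(3)[OF z] p0(2)[OF z] p1(2)[OF z] p2(2)[OF z] p3(2)[OF z]
      by (simp add: algebra_simps)
    finally show ?thesis by (simp add: add_divide_distrib)
  qed
  then show ?thesis using p0(1) p1(1) p2(1) p3(1) q(1) nonzero by blast
qed

section \<open>The degree\<close>

text \<open>
  The function on the product defined by two forms of equal bidegree; by homogeneity the choice of
  homogeneous coordinates is immaterial.
\<close>

definition form_ratio ::
  "(complex ^ 'm \<Rightarrow> complex ^ 'n \<Rightarrow> complex) \<Rightarrow> (complex ^ 'm \<Rightarrow> complex ^ 'n \<Rightarrow> complex) \<Rightarrow>
    (complex ^ 'm) set \<times> (complex ^ 'n) set \<Rightarrow> complex" where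
  "form_ratio G H p =
     G (SOME v. v \<in> fst p) (SOME w. w \<in> snd p) / H (SOME v. v \<in> fst p) (SOME w. w \<in> snd p)"

lemma form_ratio_proj_pt:
  assumes "bihom d e G" "bihom d e H" "v \<noteq> 0" "w \<noteq> 0"
  shows "form_ratio G H (proj_pt v, proj_pt w) = G v w / H v w"
proof -
  have "\<exists>a. a \<noteq> 0 \<and> (SOME v'. v' \<in> proj_pt v) = a *s v" if "v \<noteq> 0" for v :: "complex ^ 'k"
    using someI[of "\<lambda>v'. v' \<in> proj_pt v", OF proj_pt_self[OF that]] unfolding mem_proj_pt by blast
  from this[OF assms(3)] this[OF assms(4)] obtain a b where
    "a \<noteq> 0" "(SOME v'. v' \<in> proj_pt v) = a *s v" "b \<noteq> 0" "(SOME w'. w' \<in> proj_pt w) = b *s w" by blast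
  then show ?thesis
    using bihom_scale[OF assms(1)] bihom_scale[OF assms(2)] by (simp add: form_ratio_def)
qed

lemma biproj_regular_form_ratio:
  assumes "bihom d e G" "bihom d e H" "openin biproj_zariski V" "V \<subseteq> biproj_nonzero {H}"
  shows "biproj_regular V (form_ratio G H)"
proof -
  have "H v w \<noteq> 0 \<and> form_ratio G H (L, M) = G v w / H v w"
    if "(L, M) \<in> V" "v \<in> L" "w \<in> M" for L M v w
  proof -
    have LM: "(L, M) \<in> biproj_nonzero {H}" using that(1) assms(4) by blast
    then obtain v0 w0 where L: "L = proj_pt v0" "M = proj_pt w0"
      unfolding biproj_nonzero_def by (auto elim!: proj_points_cases)
    then have mem: "v \<in> proj_pt v0" "w \<in> proj_pt w0" using that(2,3) by simp_all
    then have "v \<noteq> 0" "w \<noteq> 0" by (simp_all add: proj_pt_nonzero)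
    moreover have "L = proj_pt v" "M = proj_pt w"
      using L proj_pt_eqI[OF mem(1)] proj_pt_eqI[OF mem(2)] by simp_all
    ultimately show ?thesis
      using LM mem_biproj_nonzero_single[OF assms(2), of v w] form_ratio_proj_pt[OF assms(1,2), of v w] by simp
  qed
  then show ?thesis
    unfolding biproj_regular_def using assms(1-3)
    by (intro ballI exI[of _ V] exI[of _ d] exI[of _ e] exI[of _ G] exI[of _ H]) auto
qed

text \<open>
  In the chart where the second homogeneous coordinate is 1, the Joukowski map has affine coordinate
  \<open>t + 1 / t\<close>. Hence forms pull back to polynomials in \<open>u, v\<close>, up to monomials.
\<close>

lemma joukowski_affine_vector: "t \<noteq> 0 \<Longrightarrow> joukowski t = t *s affine_vector 2 (t + 1 / t)"
  by (auto simp: vec_eq_iff forall_2 affine_vector_def field_simps power2_eq_square)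

lemma form_on_joukowski:
  assumes "bihom d e P" "\<And>z. P (affine_vector 2 (z $ 1)) (affine_vector 2 (z $ 2)) = p z" "z \<in> torus"
  shows "P (joukowski (z $ 1)) (joukowski (z $ 2)) = (z $ 1) ^ d * (z $ 2) ^ e * p (invariants z)"
proof -
  have "P (joukowski (z $ 1)) (joukowski (z $ 2)) =
      (z $ 1) ^ d * (z $ 2) ^ e * P (affine_vector 2 (invariants z $ 1)) (affine_vector 2 (invariants z $ 2))"
    using joukowski_affine_vector[OF torus_nth[OF assms(3)], of 1] joukowski_affine_vector[OF torus_nth[OF assms(3)], of 2]
      bihom_scale[OF assms(1)] by simp
  then show ?thesis unfolding assms(2) .
qed

lemma dominant_joukowski_square: "dominant affine_space P1_times_P1 joukowski_square"
proof -
  have "joukowski_square ` points affine_space = points P1_times_P1"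
    using range_joukowski_square by simp
  then show ?thesis unfolding dominant_def by (simp add: closure_of_topspace)
qed

abbreviation pulled_back_field :: "((complex ^ 2) set \<times> (complex ^ 2 \<Rightarrow> complex)) set set" where
  "pulled_back_field \<equiv>
     pullback affine_space joukowski_square ` carrier (function_field P1_times_P1)"

text \<open>
  Homogenizing \<open>p\<close> and \<open>q\<close> to the same bidegree gives a rational function on the target. Its domain is
  cut down to the points with finite coordinates, whose preimage is the torus, by including the second
  coordinates as factors of \<open>D\<close>.
\<close>

lemma inversion_symmetric_fraction_in_pulled_back_field:
  fixes p q :: "complex ^ 2 \<Rightarrow> complex"
  assumes "poly_fun p" "poly_fun q" "z0 \<in> torus" "q (invariants z0) \<noteq> 0"
  defines "W \<equiv> {z \<in> torus. q (invariants z) \<noteq> 0}"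
  shows "\<exists>\<kappa>. affine.rep W \<kappa> \<and> affine.cls W \<kappa> \<in> pulled_back_field \<and>
    (\<forall>z\<in>W. \<kappa> z = p (invariants z) / q (invariants z))"
proof -
  obtain d e P where P: "bihom d e P" "\<And>z. P (affine_vector 2 (z $ 1)) (affine_vector 2 (z $ 2)) = p z"
    using homogenization[OF assms(1)] by blast
  obtain d' e' Q where Q: "bihom d' e' Q" "\<And>z. Q (affine_vector 2 (z $ 1)) (affine_vector 2 (z $ 2)) = q z"
    using homogenization[OF assms(2)] by blast
  define m n where "m = max d d'" and "n = max e e'"
  define P' where "P' = (\<lambda>v w. P v w * ((v $ 2) ^ (m - d) * (w $ 2) ^ (n - e)))"
  define Q' where "Q' = (\<lambda>v w. Q v w * ((v $ 2) ^ (m - d') * (w $ 2) ^ (n - e')))"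
  define D where "D = (\<lambda>v w. Q' v w * (v $ 2 * w $ 2))"
  have P': "bihom m n P'" "\<And>z. P' (affine_vector 2 (z $ 1)) (affine_vector 2 (z $ 2)) = p z"
    unfolding P'_def by (rule bihom_raise_degree[OF P(1)]) (simp_all add: P(2) m_def n_def)
  have Q': "bihom m n Q'" "\<And>z. Q' (affine_vector 2 (z $ 1)) (affine_vector 2 (z $ 2)) = q z"
    unfolding Q'_def by (rule bihom_raise_degree[OF Q(1)]) (simp_all add: Q(2) m_def n_def)
  have D: "bihom (Suc m) (Suc n) D"
    unfolding D_def using bihom_raise_degree[OF Q'(1), of "Suc m" "Suc n" 2 2] by simp
  let ?V = "biproj_nonzero {D}"
  have Vopen: "openin biproj_zariski ?V" by (rule openin_biproj_nonzero_single[OF D])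
  have mem_V: "joukowski_square z \<in> ?V \<longleftrightarrow> z \<in> W" for z
  proof -
    have "joukowski_square z \<in> ?V \<longleftrightarrow> D (joukowski (z $ 1)) (joukowski (z $ 2)) \<noteq> 0"
      unfolding joukowski_square_def
      by (rule mem_biproj_nonzero_single[OF D joukowski_nonzero joukowski_nonzero])
    also have "\<dots> \<longleftrightarrow> z \<in> torus \<and> Q' (joukowski (z $ 1)) (joukowski (z $ 2)) \<noteq> 0"
      by (auto simp: D_def torus_def)
    also have "\<dots> \<longleftrightarrow> z \<in> W"
      using form_on_joukowski[OF Q'] by (auto simp: W_def torus_def)
    finally show ?thesis .
  qed
  have "?V \<subseteq> biproj_nonzero {Q'}"
    unfolding biproj_nonzero_def D_def by auto
  then have reg: "biproj_regular ?V (form_ratio P' Q')"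
    by (rule biproj_regular_form_ratio[OF P'(1) Q'(1) Vopen])
  have "joukowski_square z0 \<in> ?V" unfolding mem_V using assms(3,4) by (simp add: W_def)
  then have rep: "(?V, form_ratio P' Q') \<in> rational_reps P1_times_P1"
    using Vopen reg by (auto simp: rational_reps_def biproj_def)
  let ?\<kappa> = "\<lambda>z. form_ratio P' Q' (joukowski_square z)"
  have pre: "{z \<in> points affine_space. joukowski_square z \<in> ?V} = W" using mem_V by auto
  note pb = affine.pullback_rep[OF morphism_joukowski_square dominant_joukowski_square rep, unfolded pre]
    affine.pullback_class[OF morphism_joukowski_square dominant_joukowski_square rep, unfolded pre]
  have "rational_class P1_times_P1 ?V (form_ratio P' Q') \<in> carrier (function_field P1_times_P1)"
    using rep by (auto simp: function_field_def)
  then have "affine.cls W ?\<kappa> \<in> pulled_back_field" unfolding pb(2)[symmetric] by (rule imageI)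
  moreover have "?\<kappa> z = p (invariants z) / q (invariants z)" if "z \<in> W" for z
  proof -
    have z: "z \<in> torus" using that by (simp add: W_def)
    then have nz: "(z $ 1) ^ m * (z $ 2) ^ n \<noteq> 0" by (simp add: torus_def)
    have "?\<kappa> z = P' (joukowski (z $ 1)) (joukowski (z $ 2)) / Q' (joukowski (z $ 1)) (joukowski (z $ 2))"
      unfolding joukowski_square_def
      by (rule form_ratio_proj_pt[OF P'(1) Q'(1) joukowski_nonzero joukowski_nonzero])
    then show ?thesis
      unfolding form_on_joukowski[OF P' z] form_on_joukowski[OF Q' z]
      by (simp only: mult_divide_mult_cancel_left[OF nz])
  qed
  ultimately show ?thesis using pb(1) by blast
qed

lemma joukowski_square_invert:
  assumes "z \<in> torus" shows "joukowski_square (invert i z) = joukowski_square z"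
proof -
  have "proj_pt (joukowski (1 / t)) = proj_pt (joukowski t)" if "t \<noteq> 0" for t
  proof -
    have "joukowski (1 / t) = (1 / t ^ 2) *s joukowski t"
      using that by (auto simp: vec_eq_iff forall_2 field_simps power2_eq_square)
    then show ?thesis using proj_pt_scale[of "1 / t ^ 2"] that by simp
  qed
  then show ?thesis using torus_nth[OF assms] by (simp add: joukowski_square_def invert_nth)
qed

text \<open>
  The shape in which functions constant on the fibers of the Joukowski square enter the independence
  argument: the domain is required to be stable as well, so that all points of an orbit are available.
\<close>

definition invariant_on :: "(complex ^ 2) set \<Rightarrow> (complex ^ 2 \<Rightarrow> complex) \<Rightarrow> bool" where
  "invariant_on U \<kappa> \<longleftrightarrow> (\<forall>i. \<forall>z\<in>U \<inter> torus. invert i z \<in> U \<and> \<kappa> (invert i z) = \<kappa> z)"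

lemma invariant_onD:
  "invariant_on U \<kappa> \<Longrightarrow> z \<in> U \<Longrightarrow> z \<in> torus \<Longrightarrow> invert i z \<in> U"
  "invariant_on U \<kappa> \<Longrightarrow> z \<in> U \<Longrightarrow> z \<in> torus \<Longrightarrow> \<kappa> (invert i z) = \<kappa> z"
  by (auto simp: invariant_on_def)

lemma pulled_back_field_cases:
  assumes "k \<in> pulled_back_field"
  obtains U \<kappa> where "affine.rep U \<kappa>" "k = affine.cls U \<kappa>" "invariant_on U \<kappa>"
proof -
  obtain V \<psi> where V: "(V, \<psi>) \<in> rational_reps P1_times_P1"
    "k = pullback affine_space joukowski_square (rational_class P1_times_P1 V \<psi>)"
    using assms by (auto simp: function_field_def)
  note pb = affine.pullback_rep[OF morphism_joukowski_square dominant_joukowski_square V(1)]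
    affine.pullback_class[OF morphism_joukowski_square dominant_joukowski_square V(1)]
  have "invariant_on {z \<in> points affine_space. joukowski_square z \<in> V} (\<lambda>z. \<psi> (joukowski_square z))"
    by (auto simp: invariant_on_def joukowski_square_invert)
  then show ?thesis using that[OF pb(1)] pb(2) V(2) by simp
qed

text \<open>
  A point whose orbit under the two inversions has four elements.
\<close>

lemma generic_point:
  assumes "affine.rep U (\<kappa> :: complex ^ 2 \<Rightarrow> complex)"
  obtains z where "z \<in> U" "z \<in> torus" "(z $ 1)\<^sup>2 \<noteq> 1" "(z $ 2)\<^sup>2 \<noteq> 1"
proof -
  let ?F = "\<lambda>z :: complex ^ 2. z $ 1 * z $ 2 * (((z $ 1)\<^sup>2 - 1) * ((z $ 2)\<^sup>2 - 1))"
  have F: "poly_fun ?F"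
    by (intro poly_fun.mult poly_fun_diff poly_fun_power poly_fun.coord poly_fun.const)
  have "?F (\<chi> k. 2) \<noteq> 0" by simp
  then have "{z. ?F z \<noteq> 0} \<noteq> {}" by blast
  then have "U \<inter> {z. ?F z \<noteq> 0} \<noteq> {}"
    using assms openin_nonzero_locus[OF F] by (intro affine_opens_meet) (auto simp: affine.rep_iff)
  then obtain z where "z \<in> U" "?F z \<noteq> 0" by blast
  then show ?thesis by (intro that[of z]) (auto simp: torus_def)
qed

text \<open>
  The spaces spanned by the last one, two, three and four of the functions \<open>1, x, y, xy\<close> form a chain
  that ends with the whole function field. That each step is proper is seen by comparing the values of
  a supposed relation at a general point and at the points obtained from it by inverting coordinates.
\<close>

lemma degree_joukowski_square: "has_degree affine_space P1_times_P1 joukowski_square 4"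
proof -
  let ?R = "function_field affine_space :: ((complex ^ 2) set \<times> (complex ^ 2 \<Rightarrow> complex)) set ring"
  let ?K = pulled_back_field
  interpret R: ring ?R by (rule affine.function_field_ring)
  define mon where "mon F = affine.cls UNIV F" for F :: "complex ^ 2 \<Rightarrow> complex"
  let ?c = "\<lambda>_ :: complex ^ 2. 1 :: complex"
  let ?x = "\<lambda>z :: complex ^ 2. z $ 1" and ?y = "\<lambda>z :: complex ^ 2. z $ 2"
  let ?xy = "\<lambda>z :: complex ^ 2. z $ 1 * z $ 2"
  define E1 where "E1 = R.line_extension ?K (mon ?xy) {\<zero>\<^bsub>?R\<^esub>}"
  define E2 where "E2 = R.line_extension ?K (mon ?y) E1"
  define E3 where "E3 = R.line_extension ?K (mon ?x) E2"
  define E4 where "E4 = R.line_extension ?K (mon ?c) E3"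
  have rep_mon: "affine.rep UNIV ?c" "affine.rep UNIV ?x" "affine.rep UNIV ?y" "affine.rep UNIV ?xy"
    by (intro affine_rep_poly poly_fun.const poly_fun.coord poly_fun.mult)+
  have rep_zero: "affine.rep UNIV (\<lambda>_ :: complex ^ 2. 0)"
    by (intro affine_rep_poly poly_fun.const)
  have zero: "\<zero>\<^bsub>?R\<^esub> = affine.cls UNIV (\<lambda>_. 0)"
    by (simp add: affine.function_field_zero)
  have comb: "affine.rep (U \<inter> V) (\<lambda>z. \<kappa> z * F z + \<psi> z)"
    "affine.cls U \<kappa> \<otimes>\<^bsub>?R\<^esub> mon F \<oplus>\<^bsub>?R\<^esub> affine.cls V \<psi> = affine.cls (U \<inter> V) (\<lambda>z. \<kappa> z * F z + \<psi> z)"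
    if "affine.rep U \<kappa>" "affine.rep UNIV F" "affine.rep V \<psi>" for U V \<kappa> \<psi> F
  proof -
    have "affine.rep U (\<lambda>z. \<kappa> z * F z)" using affine.rep_mult[OF that(1,2)] by simp
    moreover have "affine.cls U \<kappa> \<otimes>\<^bsub>?R\<^esub> mon F = affine.cls U (\<lambda>z. \<kappa> z * F z)"
      unfolding mon_def using affine.function_field_mult[OF that(1,2)] by simp
    ultimately show "affine.rep (U \<inter> V) (\<lambda>z. \<kappa> z * F z + \<psi> z)"
      "affine.cls U \<kappa> \<otimes>\<^bsub>?R\<^esub> mon F \<oplus>\<^bsub>?R\<^esub> affine.cls V \<psi> = affine.cls (U \<inter> V) (\<lambda>z. \<kappa> z * F z + \<psi> z)"
      using affine.rep_add[OF _ that(3)] affine.function_field_add[OF _ that(3)] by simp_all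
  qed
  have extension_cases: "\<exists>U \<kappa> v. affine.rep U \<kappa> \<and> invariant_on U \<kappa> \<and> v \<in> E \<and>
      u = affine.cls U \<kappa> \<otimes>\<^bsub>?R\<^esub> mon F \<oplus>\<^bsub>?R\<^esub> v"
    if "u \<in> R.line_extension ?K (mon F) E" for u F E
    using that unfolding R.line_extension_mem_iff by (metis pulled_back_field_cases)
  have extensionI: "k \<otimes>\<^bsub>?R\<^esub> mon F \<oplus>\<^bsub>?R\<^esub> v \<in> R.line_extension ?K (mon F) E"
    if "k \<in> ?K" "v \<in> E" for k v F E
    using that unfolding R.line_extension_mem_iff by blast
  have E1: "\<exists>U c. affine.rep U (\<lambda>z. c z * (z $ 1 * z $ 2)) \<and> invariant_on U c \<and>
      u = affine.cls U (\<lambda>z. c z * (z $ 1 * z $ 2))" if u: "u \<in> E1" for u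
  proof -
    obtain U c v where U: "affine.rep U c" "invariant_on U c" "v \<in> {\<zero>\<^bsub>?R\<^esub>}"
      "u = affine.cls U c \<otimes>\<^bsub>?R\<^esub> mon ?xy \<oplus>\<^bsub>?R\<^esub> v"
      using extension_cases[OF u[unfolded E1_def]] by blast
    have "v = affine.cls UNIV (\<lambda>_. 0)" using U(3) zero by simp
    then show ?thesis using comb[OF U(1) rep_mon(4) rep_zero] U(2,4) by auto
  qed
  have E2: "\<exists>U b c. affine.rep U (\<lambda>z. b z * z $ 2 + c z * (z $ 1 * z $ 2)) \<and>
      invariant_on U b \<and> invariant_on U c \<and>
      u = affine.cls U (\<lambda>z. b z * z $ 2 + c z * (z $ 1 * z $ 2))" if u: "u \<in> E2" for u
  proof -
    obtain U b v where U: "affine.rep U b" "invariant_on U b" "v \<in> E1"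
      "u = affine.cls U b \<otimes>\<^bsub>?R\<^esub> mon ?y \<oplus>\<^bsub>?R\<^esub> v"
      using extension_cases[OF u[unfolded E2_def]] by blast
    obtain V c where V: "affine.rep V (\<lambda>z. c z * (z $ 1 * z $ 2))" "invariant_on V c"
      "v = affine.cls V (\<lambda>z. c z * (z $ 1 * z $ 2))" using E1[OF U(3)] by blast
    have "invariant_on (U \<inter> V) b" "invariant_on (U \<inter> V) c"
      using U(2) V(2) by (auto simp: invariant_on_def)
    then show ?thesis using comb[OF U(1) rep_mon(3) V(1)] U(4) V(3) by blast
  qed
  have E3: "\<exists>U a b c. affine.rep U (\<lambda>z. a z * z $ 1 + (b z * z $ 2 + c z * (z $ 1 * z $ 2))) \<and>
      invariant_on U a \<and> invariant_on U b \<and> invariant_on U c \<and>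
      u = affine.cls U (\<lambda>z. a z * z $ 1 + (b z * z $ 2 + c z * (z $ 1 * z $ 2)))" if u: "u \<in> E3" for u
  proof -
    obtain U a v where U: "affine.rep U a" "invariant_on U a" "v \<in> E2"
      "u = affine.cls U a \<otimes>\<^bsub>?R\<^esub> mon ?x \<oplus>\<^bsub>?R\<^esub> v"
      using extension_cases[OF u[unfolded E3_def]] by blast
    obtain V b c where V: "affine.rep V (\<lambda>z. b z * z $ 2 + c z * (z $ 1 * z $ 2))"
      "invariant_on V b" "invariant_on V c"
      "v = affine.cls V (\<lambda>z. b z * z $ 2 + c z * (z $ 1 * z $ 2))" using E2[OF U(3)] by blast
    have "invariant_on (U \<inter> V) a" "invariant_on (U \<inter> V) b" "invariant_on (U \<inter> V) c"
      using U(2) V(2,3) by (auto simp: invariant_on_def)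
    then show ?thesis using comb[OF U(1) rep_mon(2) V(1)] U(4) V(4) by blast
  qed
  have N1: "mon ?xy \<notin> {\<zero>\<^bsub>?R\<^esub>}"
  proof
    assume "mon ?xy \<in> {\<zero>\<^bsub>?R\<^esub>}"
    then have eq: "affine.cls UNIV ?xy = affine.cls UNIV (\<lambda>_. 0)" by (simp add: zero mon_def)
    show False using affine.cls_eqD[OF eq rep_zero, of "\<chi> k. 1"] by simp
  qed
  \<comment> \<open>Inverting \<open>x\<close> in \<open>y = c x y\<close> gives \<open>1 = c x\<close> and \<open>1 = c / x\<close>.\<close>
  have N2: "mon ?y \<notin> E1"
  proof
    assume "mon ?y \<in> E1"
    from E1[OF this] obtain U c where U: "affine.rep U (\<lambda>z. c z * (z $ 1 * z $ 2))" "invariant_on U c"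
      and eq: "affine.cls UNIV ?y = affine.cls U (\<lambda>z. c z * (z $ 1 * z $ 2))"
      unfolding mon_def by blast
    obtain z where z: "z \<in> U" "z \<in> torus" "(z $ 1)\<^sup>2 \<noteq> 1" using generic_point[OF U(1)] by blast
    have "z $ 2 = c z * (z $ 1 * z $ 2)" using affine.cls_eqD[OF eq U(1)] z(1) by simp
    moreover have "z $ 2 = c z * (1 / z $ 1 * z $ 2)"
      using affine.cls_eqD[OF eq U(1), of "invert 1 z"] invariant_onD[OF U(2) z(1,2), of 1]
      by (simp add: invert_nth)
    ultimately have "1 = c z * z $ 1" "z $ 1 = c z" using z(2) by (simp_all add: torus_def field_simps)
    then show False using z(3) by (simp add: power2_eq_square)
  qed
  \<comment> \<open>Inverting \<open>y\<close> in \<open>x = y (b + c x)\<close> gives \<open>x = (b + c x) / y\<close>.\<close>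
  have N3: "mon ?x \<notin> E2"
  proof
    assume "mon ?x \<in> E2"
    from E2[OF this] obtain U b c where
      U: "affine.rep U (\<lambda>z. b z * z $ 2 + c z * (z $ 1 * z $ 2))" "invariant_on U b" "invariant_on U c"
      and eq: "affine.cls UNIV ?x = affine.cls U (\<lambda>z. b z * z $ 2 + c z * (z $ 1 * z $ 2))"
      unfolding mon_def by blast
    obtain z where z: "z \<in> U" "z \<in> torus" "(z $ 2)\<^sup>2 \<noteq> 1" using generic_point[OF U(1)] by blast
    have "z $ 1 = z $ 2 * (b z + c z * z $ 1)"
      using affine.cls_eqD[OF eq U(1)] z(1) by (simp add: algebra_simps)
    moreover have "z $ 1 = 1 / z $ 2 * (b z + c z * z $ 1)"
      using affine.cls_eqD[OF eq U(1), of "invert 2 z"]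
        invariant_onD[OF U(2) z(1,2), of 2] invariant_onD[OF U(3) z(1,2), of 2]
      by (simp add: invert_nth algebra_simps)
    ultimately have "z $ 1 = z $ 2 * (z $ 1 * z $ 2)" using z(2) by (simp add: torus_def field_simps)
    then show False using z(2,3) by (simp add: torus_def power2_eq_square)
  qed
  \<comment> \<open>Inverting \<open>y\<close> in \<open>1 = a x + y (b + c x)\<close> forces \<open>b + c x = 0\<close>; inverting \<open>x\<close> in the
    remaining \<open>1 = a x\<close> then gives a contradiction.\<close>
  have N4: "mon ?c \<notin> E3"
  proof
    assume "mon ?c \<in> E3"
    from E3[OF this] obtain U a b c where
      U: "affine.rep U (\<lambda>z. a z * z $ 1 + (b z * z $ 2 + c z * (z $ 1 * z $ 2)))"
        "invariant_on U a" "invariant_on U b" "invariant_on U c"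
      and eq: "affine.cls UNIV ?c = affine.cls U (\<lambda>z. a z * z $ 1 + (b z * z $ 2 + c z * (z $ 1 * z $ 2)))"
      unfolding mon_def by blast
    obtain z where z: "z \<in> U" "z \<in> torus" "(z $ 1)\<^sup>2 \<noteq> 1" "(z $ 2)\<^sup>2 \<noteq> 1"
      using generic_point[OF U(1)] by blast
    have a_one: "a y * y $ 1 = 1" if y: "y \<in> U" "y \<in> torus" "(y $ 2)\<^sup>2 \<noteq> 1" for y
    proof -
      let ?s = "b y + c y * y $ 1"
      have 1: "1 = a y * y $ 1 + y $ 2 * ?s"
        using affine.cls_eqD[OF eq U(1)] y(1) by (simp add: algebra_simps)
      have 2: "1 = a y * y $ 1 + 1 / y $ 2 * ?s"
        using affine.cls_eqD[OF eq U(1), of "invert 2 y"] invariant_onD[OF U(2) y(1,2), of 2]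
          invariant_onD[OF U(3) y(1,2), of 2] invariant_onD[OF U(4) y(1,2), of 2]
        by (simp add: invert_nth algebra_simps)
      have "y $ 2 * ?s = 1 / y $ 2 * ?s" using 1 2 by (metis add_left_cancel)
      then have "((y $ 2)\<^sup>2 - 1) * ?s = 0"
        using y(2) by (simp add: torus_def field_simps power2_eq_square)
      then have "?s = 0" using y(3) by simp
      then show ?thesis using 1 by simp
    qed
    have "a z * z $ 1 = 1" using a_one z by blast
    moreover have "a z * (1 / z $ 1) = 1"
      using a_one[of "invert 1 z"] invariant_onD[OF U(2) z(1,2), of 1] invert_torus[OF z(2)] z(4)
      by (simp add: invert_nth)
    ultimately have "(z $ 1)\<^sup>2 = 1" using z(2) by (simp add: torus_def field_simps power2_eq_square)
    then show False using z(3) by blast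
  qed
  have dim: "R.dimension 4 ?K E4"
  proof -
    have mc: "mon F \<in> carrier ?R" if "affine.rep UNIV F" for F
      unfolding mon_def using affine.cls_in_function_field[OF that] .
    have "R.dimension (Suc (Suc (Suc (Suc 0)))) ?K E4"
      unfolding E4_def E3_def E2_def E1_def
      using N1 N2 N3 N4 rep_mon
      by (intro R.Suc_dim mc R.zero_dim) (simp_all add: E3_def E2_def E1_def)
    then show ?thesis by (simp add: eval_nat_numeral)
  qed
  have K_carrier: "?K \<subseteq> carrier ?R"
  proof
    fix k assume "k \<in> ?K"
    then show "k \<in> carrier ?R"
      by (rule pulled_back_field_cases) (simp add: affine.cls_in_function_field)
  qed
  have ext_carrier: "R.line_extension ?K (mon F) E \<subseteq> carrier ?R"
    if "E \<subseteq> carrier ?R" "affine.rep UNIV F" for F E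
  proof
    fix u assume "u \<in> R.line_extension ?K (mon F) E"
    then obtain k v where "k \<in> ?K" "v \<in> E" "u = k \<otimes>\<^bsub>?R\<^esub> mon F \<oplus>\<^bsub>?R\<^esub> v"
      unfolding R.line_extension_mem_iff by blast
    moreover have "mon F \<in> carrier ?R"
      unfolding mon_def using affine.cls_in_function_field[OF that(2)] .
    ultimately show "u \<in> carrier ?R" using K_carrier that(1) by blast
  qed
  have "E4 = carrier ?R"
  proof
    show "E4 \<subseteq> carrier ?R"
      unfolding E4_def E3_def E2_def E1_def by (intro ext_carrier rep_mon) simp
    show "carrier ?R \<subseteq> E4"
    proof
      fix a assume "a \<in> carrier ?R"
      then obtain G H c where GH: "poly_fun G" "poly_fun H" "H c \<noteq> 0"
        and a: "a = affine.cls {z. H z \<noteq> 0} (\<lambda>z. G z / H z)"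
        by (rule affine_class_fraction)
      obtain p0 p1 p2 p3 q z0 where
        poly: "poly_fun p0" "poly_fun p1" "poly_fun p2" "poly_fun p3" "poly_fun q"
        and z0: "z0 \<in> torus" "q (invariants z0) \<noteq> 0"
        and expand: "\<And>z. z \<in> torus \<Longrightarrow> H z \<noteq> 0 \<Longrightarrow> q (invariants z) \<noteq> 0 \<Longrightarrow>
          G z / H z = p0 (invariants z) / q (invariants z) + p1 (invariants z) / q (invariants z) * z $ 1 +
            p2 (invariants z) / q (invariants z) * z $ 2 +
            p3 (invariants z) / q (invariants z) * (z $ 1 * z $ 2)"
        using fraction_in_basis[OF GH] by blast
      define W where "W = {z \<in> torus. q (invariants z) \<noteq> 0}"
      have coeff: "\<exists>\<kappa>. affine.rep W \<kappa> \<and> affine.cls W \<kappa> \<in> ?K \<and>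
          (\<forall>z\<in>W. \<kappa> z = p (invariants z) / q (invariants z))" if "poly_fun p" for p
        unfolding W_def by (rule inversion_symmetric_fraction_in_pulled_back_field[OF that poly(5) z0])
      obtain k0 where k0: "affine.rep W k0" "affine.cls W k0 \<in> ?K"
        "\<And>z. z \<in> W \<Longrightarrow> k0 z = p0 (invariants z) / q (invariants z)" using coeff[OF poly(1)] by blast
      obtain k1 where k1: "affine.rep W k1" "affine.cls W k1 \<in> ?K"
        "\<And>z. z \<in> W \<Longrightarrow> k1 z = p1 (invariants z) / q (invariants z)" using coeff[OF poly(2)] by blast
      obtain k2 where k2: "affine.rep W k2" "affine.cls W k2 \<in> ?K"
        "\<And>z. z \<in> W \<Longrightarrow> k2 z = p2 (invariants z) / q (invariants z)" using coeff[OF poly(3)] by blast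
      obtain k3 where k3: "affine.rep W k3" "affine.cls W k3 \<in> ?K"
        "\<And>z. z \<in> W \<Longrightarrow> k3 z = p3 (invariants z) / q (invariants z)" using coeff[OF poly(4)] by blast
      note c3 = comb[OF k3(1) rep_mon(4) rep_zero]
      note c2 = comb[OF k2(1) rep_mon(3) c3(1)]
      note c1 = comb[OF k1(1) rep_mon(2) c2(1)]
      note c0 = comb[OF k0(1) rep_mon(1) c1(1)]
      have "a = affine.cls W k0 \<otimes>\<^bsub>?R\<^esub> mon ?c \<oplus>\<^bsub>?R\<^esub> (affine.cls W k1 \<otimes>\<^bsub>?R\<^esub> mon ?x \<oplus>\<^bsub>?R\<^esub>
          (affine.cls W k2 \<otimes>\<^bsub>?R\<^esub> mon ?y \<oplus>\<^bsub>?R\<^esub> (affine.cls W k3 \<otimes>\<^bsub>?R\<^esub> mon ?xy \<oplus>\<^bsub>?R\<^esub> \<zero>\<^bsub>?R\<^esub>)))"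
        unfolding a zero c3(2) c2(2) c1(2) c0(2)
      proof (rule affine.cls_eqI[OF affine_rep_fraction[OF GH] c0(1)])
        fix z assume "z \<in> {z. H z \<noteq> 0}" and "z \<in> W \<inter> (W \<inter> (W \<inter> (W \<inter> UNIV)))"
        then have z: "z \<in> W" "z \<in> torus" "H z \<noteq> 0" "q (invariants z) \<noteq> 0" by (auto simp: W_def)
        show "G z / H z = k0 z * 1 + (k1 z * z $ 1 + (k2 z * z $ 2 + (k3 z * (z $ 1 * z $ 2) + 0)))"
          unfolding expand[OF z(2-4)] k0(3)[OF z(1)] k1(3)[OF z(1)] k2(3)[OF z(1)] k3(3)[OF z(1)]
          by simp
      qed
      then show "a \<in> E4"
        unfolding E4_def E3_def E2_def E1_def
        by (simp only:) (intro extensionI k0(2) k1(2) k2(2) k3(2) singletonI)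
    qed
  qed
  then show ?thesis
    unfolding has_degree_def
    using dim morphism_joukowski_square dominant_joukowski_square by simp
qed

theorem proposition2p3:
  shows "\<exists>f :: complex ^ 2 \<Rightarrow> (complex ^ 2) set \<times> (complex ^ 2) set.
           pseudo_chart P1_times_P1 f \<and>
           finite_fibers P1_times_P1 f \<and>
           has_degree affine_space P1_times_P1 f 4 \<and>
           covered_by P1_times_P1 {f}"
  using pseudo_chart_joukowski_square finite_fibers_joukowski_square degree_joukowski_square
    range_joukowski_square
  by (intro exI[of _ joukowski_square]) (simp add: covered_by_def)

end
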